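(* Let $R=\mathbb{Z}_2[x,y,x^{-1},y^{-1}]$, let $f,g\in R$ satisfy the topological order condition, and consider the stabilizer code defined by $f,g$ on untwisted $L_x\times L_y$ tori. The minimal torus lengths $L_x$ and $L_y$ for which the code achieves $k=k_{\max}$ are the smallest values satisfying $$x^{L_x}-1,\quad y^{L_y}-1\in\langle f(x,y),g(x,y)\rangle .$$ That is: let $L_x^{*}$ (resp. $L_y^{*}$) be the smallest positive integer with $x^{L_x^{*}}-1\in\langle f,g\rangle$ (resp. $y^{L_y^{*}}-1\in\langle f,g\rangle$). Then the code on the untwisted $L_x^{*}\times L_y^{*}$ torus has $k=k_{\max}$, and if the code on an untwisted $L_x\times L_y$ torus ($L_x,L_y\ge1$) has $k=k_{\max}$, then $L_x\ge L_x^{*}$ and $L_y\ge L_y^{*}$.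
   Context: The code. $R=\mathbb{Z}_2[x,y,x^{-1},y^{-1}]$ is the Laurent polynomial ring over the field with two elements. For $p\in R$, $\overline{p}$ is the image of $p$ under the $\mathbb{Z}_2$-linear antipode map $x^ny^m\mapsto x^{-n}y^{-m}$. On the square lattice with two qubits per unit cell (cells indexed by $\mathbb{Z}^2$), Pauli operators of pure $X$-type (or pure $Z$-type) are encoded as elements of $R^2$, the coefficient of $x^ny^m$ in the $i$-th component indicating whether the operator acts on the $i$-th qubit of cell $(n,m)$. Given $f,g\in R$, the translation-invariant CSS stabilizer code defined by $f,g$ has $X$-stabilizer generators all $x^ny^m\,(f,g)$ and $Z$-stabilizer generators all $x^ny^m\,(\overline{g},\overline{f})$, $n,m\in\mathbb{Z}$. Torus. The untwisted $L_x\times L_y$ torus ($L_x,L_y\ge1$ integers) is obtained by identifying cells that differ by an element of the lattice generated by $(L_x,0)$ and $(0,L_y)$; algebraically $R$ is replaced by $S=R/\langle x^{L_x}-1,\;y^{L_y}-1\rangle$. The code on this torus has $n=2L_xL_y$ physical qubits. Logical dimension. $k=n-\dim_{\mathbb{Z}_2}\{(sf,sg):s\in S\}-\dim_{\mathbb{Z}_2}\{(s\overline{g},s\overline{f}):s\in S\}$ (subspaces of $S^2$), i.e. $n-\operatorname{rank}H_X-\operatorname{rank}H_Z$ for the parity-check matrices of the $X$- and $Z$-stabilizers. Maximal logical dimension. $k_{\max}=2\dim_{\mathbb{Z}_2}\left(R/\langle f,g\rangle\right)$, which is the maximum of the logical dimension over all tori. Topological order condition. On the infinite plane, every finitely supported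 Pauli operator commuting with all stabilizers is a finite product of stabilizers; equivalently, $f$ and $g$ are coprime in $R$ (every common divisor is a unit of $R$). *)

theory Defs
  imports
    "HOL-Library.Poly_Mapping"
    "HOL-Library.Product_Plus"
    "HOL-Library.Z2"
    "HOL-Algebra.QuotRing"
    "Jordan_Normal_Form.VS_Connect"
begin

subsection \<open>The Laurent polynomial ring\<close>

text \<open>The Laurent polynomials in \<open>x, y\<close> over the field with two elements are the group algebra
  of \<open>\<int>\<^sup>2\<close>: finitely supported functions on exponent pairs, with convolution as multiplication.\<close>

type_synonym laurent = "(int \<times> int) \<Rightarrow>\<^sub>0 bit"

definition lmonom :: "int \<times> int \<Rightarrow> laurent" where
  "lmonom c = Poly_Mapping.single c 1"

abbreviation X :: laurent where "X \<equiv> lmonom (1, 0)"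
abbreviation Y :: laurent where "Y \<equiv> lmonom (0, 1)"

definition antipode :: "laurent \<Rightarrow> laurent" where
  "antipode p = Poly_Mapping.map_key uminus p"

lemma lookup_antipode: "Poly_Mapping.lookup (antipode p) c = Poly_Mapping.lookup p (- c)"
  unfolding antipode_def by (subst map_key.rep_eq) (simp_all add: inj_def)

lemma antipode_lmonom: "antipode (lmonom (n, m)) = lmonom (- n, - m)"
  by (rule poly_mapping_eqI)
    (auto simp: lookup_antipode lmonom_def lookup_single when_def prod_eq_iff)

lemma antipode_add: "antipode (p + q) = antipode p + antipode q"
  by (rule poly_mapping_eqI) (simp add: lookup_antipode lookup_add)

text \<open>\<^term>\<open>class_ring\<close> turns a type-class ring into a record of \<open>HOL-Algebra\<close>.\<close>

abbreviation R :: "laurent ring" where "R \<equiv> class_ring"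
abbreviation \<F>\<^sub>2 :: "bit ring" where "\<F>\<^sub>2 \<equiv> class_ring"

subsection \<open>Pauli operators on the infinite plane and topological order\<close>

text \<open>A finitely supported Pauli operator up to phase: its \<open>X\<close>-part and its \<open>Z\<close>-part, each one
  giving, for both qubits of a cell, the set of cells acted upon. Products of operators become
  sums.\<close>

type_synonym pauli = "(laurent \<times> laurent) \<times> (laurent \<times> laurent)"

definition overlap :: "laurent \<Rightarrow> laurent \<Rightarrow> bit" where
  "overlap p q =
    (\<Sum>c\<in>Poly_Mapping.keys p. Poly_Mapping.lookup p c * Poly_Mapping.lookup q c)"

text \<open>Two Pauli operators commute iff the number of qubits on which one acts by \<open>X\<close> and the other
  by \<open>Z\<close>, counted in both directions, is even.\<close>

fun commutes :: "pauli \<Rightarrow> pauli \<Rightarrow> bool" where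
  "commutes ((a, b), (c, d)) ((a', b'), (c', d')) \<longleftrightarrow>
     overlap a c' + overlap b d' + overlap c a' + overlap d b' = 0"

definition stabilizers :: "laurent \<Rightarrow> laurent \<Rightarrow> pauli set" where
  "stabilizers f g =
     range (\<lambda>c. ((lmonom c * f, lmonom c * g), (0, 0))) \<union>
     range (\<lambda>c. ((0, 0), (lmonom c * antipode g, lmonom c * antipode f)))"

definition topological_order :: "laurent \<Rightarrow> laurent \<Rightarrow> bool" where
  "topological_order f g \<longleftrightarrow>
     (\<forall>P. (\<forall>T\<in>stabilizers f g. commutes P T) \<longrightarrow>
          (\<exists>Ts. set Ts \<subseteq> stabilizers f g \<and> P = sum_list Ts))"

subsection \<open>Quotients as vector spaces over the two-element field\<close>

definition quot_space :: "laurent set \<Rightarrow> (bit, laurent set) module" where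
  "quot_space I =
     \<lparr>carrier = carrier (R Quot I), mult = mult (R Quot I), one = one (R Quot I),
      zero = zero (R Quot I), add = add (R Quot I),
      smult = (\<lambda>c u. (I +>\<^bsub>R\<^esub> Poly_Mapping.single 0 c) \<otimes>\<^bsub>R Quot I\<^esub> u)\<rparr>"

lemma quot_space_vectorspace:
  assumes "ideal I R"
  shows "vectorspace \<F>\<^sub>2 (quot_space I)"
proof -
  interpret I: ideal I R by fact
  interpret Q: cring "R Quot I"
    by (rule I.quotient_is_cring) (rule class_cring.cring_axioms)
  interpret h: ring_hom_cring R "R Quot I" "(+>\<^bsub>R\<^esub>) I"
    by (rule I.rcos_ring_hom_cring) (rule class_cring.cring_axioms)
  have sc: "I +>\<^bsub>R\<^esub> p \<in> carrier (R Quot I)" for p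
    using h.hom_closed[of p] by simp
  have ab: "abelian_group (quot_space I)"
    by (rule abelian_groupI)
      (auto simp: quot_space_def Q.a_ac intro: Q.l_neg Q.a_inv_closed)
  have add: "I +>\<^bsub>R\<^esub> (p + q) = (I +>\<^bsub>R\<^esub> p) \<oplus>\<^bsub>R Quot I\<^esub> (I +>\<^bsub>R\<^esub> q)" for p q
    using h.hom_add[of p q] by simp
  have mult: "I +>\<^bsub>R\<^esub> (p * q) = (I +>\<^bsub>R\<^esub> p) \<otimes>\<^bsub>R Quot I\<^esub> (I +>\<^bsub>R\<^esub> q)" for p q
    using h.hom_mult[of p q] by simp
  have one: "I +>\<^bsub>R\<^esub> 1 = \<one>\<^bsub>R Quot I\<^esub>"
    using h.hom_one by simp
  have "module \<F>\<^sub>2 (quot_space I)"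
  proof (rule moduleI)
    show "cring \<F>\<^sub>2" by (rule class_cring.cring_axioms)
  next
    fix c d :: bit and u
    assume "u \<in> carrier (quot_space I)"
    then have u: "u \<in> carrier (R Quot I)" by (simp add: quot_space_def)
    have "Poly_Mapping.single 0 (c * d) =
        (Poly_Mapping.single 0 c * Poly_Mapping.single 0 d :: laurent)"
      by (simp add: mult_single)
    then show "(c \<otimes>\<^bsub>\<F>\<^sub>2\<^esub> d) \<odot>\<^bsub>quot_space I\<^esub> u = c \<odot>\<^bsub>quot_space I\<^esub> (d \<odot>\<^bsub>quot_space I\<^esub> u)"
      using u sc by (simp add: quot_space_def mult Q.m_assoc)
  next
    fix c d :: bit and u
    assume "u \<in> carrier (quot_space I)"
    then have u: "u \<in> carrier (R Quot I)" by (simp add: quot_space_def)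
    have "I +>\<^bsub>R\<^esub> Poly_Mapping.single 0 (c + d) =
        (I +>\<^bsub>R\<^esub> Poly_Mapping.single 0 c) \<oplus>\<^bsub>R Quot I\<^esub> (I +>\<^bsub>R\<^esub> Poly_Mapping.single 0 d)"
      by (simp only: single_add add)
    then show "(c \<oplus>\<^bsub>\<F>\<^sub>2\<^esub> d) \<odot>\<^bsub>quot_space I\<^esub> u =
        c \<odot>\<^bsub>quot_space I\<^esub> u \<oplus>\<^bsub>quot_space I\<^esub> d \<odot>\<^bsub>quot_space I\<^esub> u"
      using Q.l_distr[OF sc sc u] by (simp only: quot_space_def module.simps ring.simps monoid.simps
          partial_object.simps)
  qed (use ab in \<open>simp_all add: quot_space_def sc one Q.r_distr\<close>)
  moreover have "field \<F>\<^sub>2" by (rule class_field.field_axioms)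
  ultimately show ?thesis by (simp add: vectorspace_def)
qed

text \<open>For \<open>S = R/I\<close>, the subspace of all \<open>(s a, s b)\<close> with \<open>s \<in> S\<close>, as a vector space with the
  operations of \<open>S\<^sup>2\<close>.\<close>

definition stab_space ::
  "laurent set \<Rightarrow> laurent \<Rightarrow> laurent \<Rightarrow> (bit, laurent set \<times> laurent set) module" where
  "stab_space I a b =
     (direct_sum (quot_space I) (quot_space I))
       \<lparr>carrier := {(s \<otimes>\<^bsub>R Quot I\<^esub> (I +>\<^bsub>R\<^esub> a), s \<otimes>\<^bsub>R Quot I\<^esub> (I +>\<^bsub>R\<^esub> b)) |s.
                     s \<in> carrier (R Quot I)}\<rparr>"

lemma stab_space_vectorspace:
  assumes "ideal I R"
  shows "vectorspace \<F>\<^sub>2 (stab_space I a b)"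
proof -
  interpret I: ideal I R by fact
  interpret Q: cring "R Quot I"
    by (rule I.quotient_is_cring) (rule class_cring.cring_axioms)
  interpret h: ring_hom_cring R "R Quot I" "(+>\<^bsub>R\<^esub>) I"
    by (rule I.rcos_ring_hom_cring) (rule class_cring.cring_axioms)
  have sc: "I +>\<^bsub>R\<^esub> p \<in> carrier (R Quot I)" for p
    using h.hom_closed[of p] by simp
  interpret V: vectorspace \<F>\<^sub>2 "quot_space I"
    by (rule quot_space_vectorspace) fact
  let ?V = "direct_sum (quot_space I) (quot_space I)"
  interpret VV: vectorspace \<F>\<^sub>2 ?V
    by (rule direct_sum_is_vs) (rule V.vectorspace_axioms)+
  let ?W = "{(s \<otimes>\<^bsub>R Quot I\<^esub> (I +>\<^bsub>R\<^esub> a), s \<otimes>\<^bsub>R Quot I\<^esub> (I +>\<^bsub>R\<^esub> b)) |s.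
    s \<in> carrier (R Quot I)}"
  have "submodule \<F>\<^sub>2 ?W ?V"
  proof unfold_locales
    show "?W \<subseteq> carrier ?V"
      by (auto simp: direct_sum_def quot_space_def sc)
  next
    have "\<exists>s. \<zero>\<^bsub>R Quot I\<^esub> = s \<otimes>\<^bsub>R Quot I\<^esub> (I +>\<^bsub>R\<^esub> a) \<and>
      \<zero>\<^bsub>R Quot I\<^esub> = s \<otimes>\<^bsub>R Quot I\<^esub> (I +>\<^bsub>R\<^esub> b) \<and> s \<in> carrier (R Quot I)"
      by (rule exI[of _ "\<zero>\<^bsub>R Quot I\<^esub>"]) (simp add: sc)
    then show "\<zero>\<^bsub>?V\<^esub> \<in> ?W"
      by (simp add: direct_sum_def quot_space_def)
  next
    fix v w assume "v \<in> ?W" "w \<in> ?W"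
    then obtain s t where "s \<in> carrier (R Quot I)" "t \<in> carrier (R Quot I)"
      "v = (s \<otimes>\<^bsub>R Quot I\<^esub> (I +>\<^bsub>R\<^esub> a), s \<otimes>\<^bsub>R Quot I\<^esub> (I +>\<^bsub>R\<^esub> b))"
      "w = (t \<otimes>\<^bsub>R Quot I\<^esub> (I +>\<^bsub>R\<^esub> a), t \<otimes>\<^bsub>R Quot I\<^esub> (I +>\<^bsub>R\<^esub> b))"
      by auto
    then show "v \<oplus>\<^bsub>?V\<^esub> w \<in> ?W"
      by (auto simp: direct_sum_def quot_space_def sc Q.l_distr
          intro!: exI[of _ "s \<oplus>\<^bsub>R Quot I\<^esub> t"])
  next
    fix c v assume "v \<in> ?W"
    then obtain s where "s \<in> carrier (R Quot I)"
      "v = (s \<otimes>\<^bsub>R Quot I\<^esub> (I +>\<^bsub>R\<^esub> a), s \<otimes>\<^bsub>R Quot I\<^esub> (I +>\<^bsub>R\<^esub> b))"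
      by auto
    then show "c \<odot>\<^bsub>?V\<^esub> v \<in> ?W"
      by (auto simp: direct_sum_def quot_space_def sc Q.m_assoc
          intro!: exI[of _ "(I +>\<^bsub>R\<^esub> Poly_Mapping.single 0 c) \<otimes>\<^bsub>R Quot I\<^esub> s"])
  qed
  then have "subspace \<F>\<^sub>2 ?W ?V"
    using VV.vectorspace_axioms by (simp only: subspace_def)
  then show ?thesis
    unfolding stab_space_def by (rule VV.subspace_is_vs)
qed

subsection \<open>Logical dimensions\<close>

definition torus_ideal :: "nat \<Rightarrow> nat \<Rightarrow> laurent set" where
  "torus_ideal Lx Ly = Idl\<^bsub>R\<^esub> {X ^ Lx - 1, Y ^ Ly - 1}"

definition logical_dim :: "laurent \<Rightarrow> laurent \<Rightarrow> nat \<Rightarrow> nat \<Rightarrow> int" where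
  "logical_dim f g Lx Ly =
     2 * int Lx * int Ly
     - int (vectorspace.dim \<F>\<^sub>2 (stab_space (torus_ideal Lx Ly) f g))
     - int (vectorspace.dim \<F>\<^sub>2 (stab_space (torus_ideal Lx Ly) (antipode g) (antipode f)))"

definition k_max :: "laurent \<Rightarrow> laurent \<Rightarrow> int" where
  "k_max f g = 2 * int (vectorspace.dim \<F>\<^sub>2 (quot_space (Idl\<^bsub>R\<^esub> {f, g})))"

definition is_minimal_length :: "laurent \<Rightarrow> laurent \<Rightarrow> laurent \<Rightarrow> nat \<Rightarrow> bool" where
  "is_minimal_length u f g L \<longleftrightarrow>
     L > 0 \<and> u ^ L - 1 \<in> Idl\<^bsub>R\<^esub> {f, g} \<and>
     (\<forall>L'>0. u ^ L' - 1 \<in> Idl\<^bsub>R\<^esub> {f, g} \<longrightarrow> L \<le> L')"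

end

theory Submission
  imports Defs
begin

text \<open>
  Let \<open>I = \<langle>f, g\<rangle>\<close> and \<open>J = I + \<langle>x\<^bsup>Lx\<^esup> - 1, y\<^bsup>Ly\<^esup> - 1\<rangle>\<close>. The coefficient of \<open>1\<close> in a product is a
  nondegenerate pairing on the group algebra \<open>S\<close> of the torus, for which the annihilator of
  \<open>(f, g)\<close> is the orthogonal complement of the ideal \<open>JS\<close>. Hence each of the two stabilizer spaces
  has as many elements as \<open>JS\<close>, so that \<open>k = 2 dim (R/J)\<close>. Once \<open>R/I\<close> is known to be finite, this
  equals \<open>k\<^sub>m\<^sub>a\<^sub>x = 2 dim (R/I)\<close> iff \<open>J = I\<close>, and some power of \<open>x\<close> and of \<open>y\<close> is \<open>1\<close> modulo \<open>I\<close> because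
  both are units.

  Topological order says that \<open>(f, g)\<close> generates the syzygies of \<open>(g, f)\<close>, and finiteness of \<open>R/I\<close>
  follows from this by counting, without any elimination theory: let \<open>d\<^sub>x\<close> and \<open>d\<^sub>y\<close> be the extents of
  the joint support of \<open>f\<close> and \<open>g\<close>. The elements \<open>a g + b f\<close> with \<open>a, b\<close> supported in an \<open>N \<times> N\<close> box
  lie in a box of size \<open>(N + d\<^sub>x) (N + d\<^sub>y)\<close>, and the pairs with \<open>a g + b f = 0\<close> are parametrized by a
  box of size \<open>(N - d\<^sub>x) (N - d\<^sub>y)\<close>. The codimension is therefore at most
  \<open>(N + d\<^sub>x) (N + d\<^sub>y) - 2 N\<^sup>2 + (N - d\<^sub>x) (N - d\<^sub>y) = 2 d\<^sub>x d\<^sub>y\<close>, independently of \<open>N\<close>.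
\<close>

subsection \<open>Laurent polynomials and syzygies\<close>

lemma bit_cases: "x = 0 \<or> x = (1 :: bit)"
  by (cases x) auto

text \<open>Over two elements every nonzero coefficient is 1, so a Laurent polynomial is determined
  by its support.\<close>

lemma laurent_sum: "(p :: laurent) = (\<Sum>e\<in>Poly_Mapping.keys p. lmonom e)"
proof (rule poly_mapping_eqI)
  fix k
  have "Poly_Mapping.lookup p k = (1 when k \<in> Poly_Mapping.keys p)"
    using bit_cases[of "Poly_Mapping.lookup p k"] by (auto simp: when_def in_keys_iff)
  also have "\<dots> = (\<Sum>e\<in>Poly_Mapping.keys p. Poly_Mapping.lookup (lmonom e) k)"
    by (simp add: lmonom_def lookup_single when_def)
  finally show "Poly_Mapping.lookup p k = Poly_Mapping.lookup (\<Sum>e\<in>Poly_Mapping.keys p. lmonom e) k"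
    by (simp add: lookup_sum)
qed

text \<open>Monomials generate the additive group, so additivity alone settles equality. This
  reduces the bilinear identities below to monomials.\<close>

lemma additive_ext:
  fixes F G :: "laurent \<Rightarrow> 'a :: ab_group_add"
  assumes "\<And>p q. F (p + q) = F p + F q" and "\<And>p q. G (p + q) = G p + G q"
    and "\<And>c. F (lmonom c) = G (lmonom c)"
  shows "F p = G p"
proof -
  have 0: "F 0 = 0" "G 0 = 0"
    using assms(1)[of 0 0] assms(2)[of 0 0] by simp_all
  have "F (sum lmonom A) = G (sum lmonom A)" if "finite A" for A
    using that by induction (simp_all add: assms 0)
  then show ?thesis
    by (subst (1 2) laurent_sum) simp
qed

lemma lmonom_mult: "lmonom a * lmonom b = lmonom (a + b)"
  by (simp add: lmonom_def mult_single)

lemma lmonom_0: "lmonom 0 = 1"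
  by (simp add: lmonom_def)

lemma lookup_lmonom_mult: "Poly_Mapping.lookup (lmonom c * q) e = Poly_Mapping.lookup q (e - c)"
proof (rule additive_ext[where F = "\<lambda>q. Poly_Mapping.lookup (lmonom c * q) e" and G = "\<lambda>q. Poly_Mapping.lookup q (e - c)"])
  show "Poly_Mapping.lookup (lmonom c * lmonom d) e = Poly_Mapping.lookup (lmonom d) (e - c)" for d
    by (auto simp: lmonom_mult) (auto simp: lmonom_def lookup_single when_def)
qed (simp_all add: lookup_add distrib_left)

lemma lookup_mult_laurent:
  "Poly_Mapping.lookup (p * q) c = (\<Sum>e\<in>Poly_Mapping.keys p. Poly_Mapping.lookup p e * Poly_Mapping.lookup q (c - e))" for p q :: laurent
proof -
  have "p * q = (\<Sum>e\<in>Poly_Mapping.keys p. lmonom e * q)"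
    by (subst (1) laurent_sum) (simp add: sum_distrib_right)
  then have "Poly_Mapping.lookup (p * q) c = (\<Sum>e\<in>Poly_Mapping.keys p. Poly_Mapping.lookup q (c - e))"
    by (simp add: lookup_sum lookup_lmonom_mult)
  also have "\<dots> = (\<Sum>e\<in>Poly_Mapping.keys p. Poly_Mapping.lookup p e * Poly_Mapping.lookup q (c - e))"
  proof (rule sum.cong)
    fix e assume "e \<in> Poly_Mapping.keys p"
    then have "Poly_Mapping.lookup p e = 1" using bit_cases[of "Poly_Mapping.lookup p e"] by (auto simp: in_keys_iff)
    then show "Poly_Mapping.lookup q (c - e) = Poly_Mapping.lookup p e * Poly_Mapping.lookup q (c - e)" by simp
  qed simp
  finally show ?thesis .
qed

lemma antipode_antipode [simp]: "antipode (antipode p) = p"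
  by (rule poly_mapping_eqI) (simp add: lookup_antipode)

lemma antipode_mult: "antipode (p * q) = antipode p * antipode q"
proof (rule additive_ext[where F = "\<lambda>q. antipode (p * q)" and G = "\<lambda>q. antipode p * antipode q"])
  fix c
  show "antipode (p * lmonom c) = antipode p * antipode (lmonom c)"
  proof (rule additive_ext[where F = "\<lambda>p. antipode (p * lmonom c)"
        and G = "\<lambda>p. antipode p * antipode (lmonom c)"])
    show "antipode (lmonom d * lmonom c) = antipode (lmonom d) * antipode (lmonom c)" for d
      by (cases c; cases d) (simp add: lmonom_mult antipode_lmonom)
  qed (simp_all add: antipode_add distrib_right)
qed (simp_all add: antipode_add distrib_left)

lemma antipode_0 [simp]: "antipode 0 = 0"
  by (rule poly_mapping_eqI) (simp add: lookup_antipode)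

lemma antipode_diff: "antipode (p - q) = antipode p - antipode q"
  by (rule poly_mapping_eqI) (simp add: lookup_antipode lookup_minus)

lemma lmonom_power: "lmonom (a, b) ^ n = lmonom (int n * a, int n * b)"
  by (induction n) (simp_all add: lmonom_mult lmonom_0[unfolded zero_prod_def] algebra_simps)

text \<open>The antipode turns the overlap with a translate into a convolution. Commuting with all
  Z-stabilizers thus becomes the vanishing of one Laurent polynomial, coefficient by
  coefficient.\<close>

lemma overlap_antipode: "overlap a (lmonom c * antipode g) = Poly_Mapping.lookup (a * g) c"
  by (simp only: overlap_def lookup_mult_laurent[of a g] lookup_lmonom_mult lookup_antipode minus_diff_eq)

lemma stabilizer_products:
  assumes "set Ts \<subseteq> stabilizers f g"
  shows "\<exists>s t. sum_list Ts = ((s * f, s * g), (t * antipode g, t * antipode f))"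
  using assms
proof (induction Ts)
  case Nil
  then show ?case by (intro exI[of _ 0]) (simp add: zero_prod_def)
next
  case (Cons T Ts)
  then obtain s t where st: "sum_list Ts = ((s * f, s * g), (t * antipode g, t * antipode f))"
    by auto
  from Cons.prems obtain c where
    "T = ((lmonom c * f, lmonom c * g), (0, 0)) \<or>
     T = ((0, 0), (lmonom c * antipode g, lmonom c * antipode f))"
    by (auto simp: stabilizers_def)
  then show ?case
  proof
    assume "T = ((lmonom c * f, lmonom c * g), (0, 0))"
    then show ?thesis
      by (intro exI[of _ "lmonom c + s"] exI[of _ t]) (simp add: st distrib_right)
  next
    assume "T = ((0, 0), (lmonom c * antipode g, lmonom c * antipode f))"
    then show ?thesis
      by (intro exI[of _ s] exI[of _ "lmonom c + t"]) (simp add: st distrib_right)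
  qed
qed

text \<open>A syzygy, read as an operator of pure X-type, commutes trivially with the X-stabilizers,
  and with the Z-stabilizers because \<open>a * g + b * f\<close> has no nonzero coefficient.
  Comparing X-parts in the resulting product of stabilizers gives the multiplier
  \<open>s\<close>.\<close>

lemma topological_order_syzygy:
  assumes "topological_order f g" and "a * g + b * f = 0"
  shows "\<exists>s. a = s * f \<and> b = s * g"
proof -
  let ?P = "((a, b), (0, 0)) :: pauli"
  have "commutes ?P T" if "T \<in> stabilizers f g" for T
  proof -
    have *: "Poly_Mapping.lookup (a * g) c + Poly_Mapping.lookup (b * f) c = 0" for c
      by (simp only: assms(2) lookup_zero flip: lookup_add)
    have "overlap p 0 = 0" "overlap 0 p = 0" for p
      by (simp_all add: overlap_def)
    with that * show ?thesis
      unfolding stabilizers_def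
      by (elim UnE rangeE) (simp_all only: commutes.simps overlap_antipode add_0_right)
  qed
  with assms(1) obtain Ts where "set Ts \<subseteq> stabilizers f g" "?P = sum_list Ts"
    unfolding topological_order_def by blast
  with stabilizer_products show ?thesis
    by (metis prod.inject)
qed

text \<open>For \<open>f = g = 0\<close> the pair (1, 1) would be a syzygy without being a multiple
  of (0, 0).\<close>

lemma topological_order_nonzero:
  assumes "topological_order f g"
  shows "f \<noteq> 0 \<or> g \<noteq> 0"
  using topological_order_syzygy[OF assms, of 1 1] by auto

section \<open>Extremal exponents of products, and polynomials with prescribed support\<close>

lemma finite_two_key_max:
  fixes u v :: "'a \<Rightarrow> int"
  assumes "finite A" "A \<noteq> {}"
  shows "\<exists>a\<in>A. \<forall>x\<in>A. u x \<le> u a \<and> (u x = u a \<longrightarrow> v x \<le> v a)"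
proof -
  have ex: "\<exists>a\<in>B. \<forall>x\<in>B. w x \<le> w a" if "finite B" "B \<noteq> {}" for B and w :: "'a \<Rightarrow> int"
  proof -
    have "Max (w ` B) \<in> w ` B" using that by simp
    then obtain a where "a \<in> B" "w a = Max (w ` B)" by auto
    with that show ?thesis by (intro bexI[of _ a]) simp_all
  qed
  obtain b where b: "b \<in> A" "\<And>x. x \<in> A \<Longrightarrow> u x \<le> u b"
    using ex[OF assms] by blast
  then obtain a where "a \<in> {x \<in> A. u x = u b}" "\<And>x. x \<in> {x \<in> A. u x = u b} \<Longrightarrow> v x \<le> v a"
    using ex[of "{x \<in> A. u x = u b}" v] assms by auto
  with b show ?thesis by (intro bexI[of _ a]) auto
qed

text \<open>The keys \<open>u\<close>, \<open>v\<close> define a lexicographic order compatible with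
  addition. The leading exponents \<open>a\<close> and \<open>b\<close> are the only pair of
  exponents with sum \<open>a + b\<close>, so this term cannot cancel.\<close>

lemma keys_mult_extremal:
  fixes p q :: laurent and u v :: "int \<times> int \<Rightarrow> int"
  assumes "p \<noteq> 0" "q \<noteq> 0"
    and u: "\<And>a b. u (a + b) = u a + u b" and v: "\<And>a b. v (a + b) = v a + v b"
    and inj: "inj (\<lambda>e. (u e, v e))"
  shows "\<exists>a\<in>Poly_Mapping.keys p. \<exists>b\<in>Poly_Mapping.keys q.
    a + b \<in> Poly_Mapping.keys (p * q) \<and> (\<forall>x\<in>Poly_Mapping.keys p. u x \<le> u a) \<and>
    (\<forall>x\<in>Poly_Mapping.keys q. u x \<le> u b)"
proof -
  have "Poly_Mapping.keys p \<noteq> {}" "Poly_Mapping.keys q \<noteq> {}"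
    using assms by auto
  then obtain a b where a: "a \<in> Poly_Mapping.keys p"
      "\<And>x. x \<in> Poly_Mapping.keys p \<Longrightarrow> u x \<le> u a \<and> (u x = u a \<longrightarrow> v x \<le> v a)"
    and b: "b \<in> Poly_Mapping.keys q"
      "\<And>x. x \<in> Poly_Mapping.keys q \<Longrightarrow> u x \<le> u b \<and> (u x = u b \<longrightarrow> v x \<le> v b)"
    using finite_two_key_max[of "Poly_Mapping.keys p" u v]
      finite_two_key_max[of "Poly_Mapping.keys q" u v] by (metis finite_keys)
  \<comment> \<open>A second contribution would have to tie with the maxima in \<open>u\<close> and
    then in \<open>v\<close>, and injectivity would give \<open>e = a\<close>.\<close>
  have zero: "Poly_Mapping.lookup p e * Poly_Mapping.lookup q (a + b - e) = 0" if "e \<in> Poly_Mapping.keys p" "e \<noteq> a" for e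
  proof (rule ccontr)
    assume "\<not> ?thesis"
    then have e': "a + b - e \<in> Poly_Mapping.keys q" by (auto simp: in_keys_iff)
    have "u a + u b = u e + u (a + b - e)" "v a + v b = v e + v (a + b - e)"
      by (simp_all flip: u v)
    with a(2)[OF that(1)] b(2)[OF e'] have "u e = u a" "v e = v a" by auto
    then show False using injD[OF inj, of e a] that by simp
  qed
  have "Poly_Mapping.lookup (p * q) (a + b) =
      (\<Sum>e\<in>Poly_Mapping.keys p. if e = a then Poly_Mapping.lookup p a * Poly_Mapping.lookup q b else 0)"
    unfolding lookup_mult_laurent by (rule sum.cong) (use zero in auto)
  also have "\<dots> = Poly_Mapping.lookup p a * Poly_Mapping.lookup q b" using a by simp
  finally have "a + b \<in> Poly_Mapping.keys (p * q)"
    using a b by (auto simp: in_keys_iff)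
  then show ?thesis using a b by blast
qed

definition supported_on :: "(int \<times> int) set \<Rightarrow> laurent set" where
  "supported_on A = {p. Poly_Mapping.keys p \<subseteq> A}"

lemma keys_sum_lmonom:
  assumes "finite K"
  shows "Poly_Mapping.keys (sum lmonom K) = K"
proof -
  have "Poly_Mapping.lookup (sum lmonom K) e = (if e \<in> K then 1 else 0)" for e
    using assms by (simp add: lookup_sum lmonom_def lookup_single when_def)
  then show ?thesis by (simp add: set_eq_iff in_keys_iff)
qed

lemma card_supported_on:
  assumes "finite A"
  shows "finite (supported_on A)" "card (supported_on A) = 2 ^ card A"
proof -
  have bij: "bij_betw Poly_Mapping.keys (supported_on A) (Pow A)"
  proof (rule bij_betwI[where g = "sum lmonom"])
    show "Poly_Mapping.keys \<in> supported_on A \<rightarrow> Pow A" by (auto simp: supported_on_def)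
    show "sum lmonom \<in> Pow A \<rightarrow> supported_on A"
      using finite_subset[OF _ assms] by (auto simp: supported_on_def keys_sum_lmonom)
    show "sum lmonom (Poly_Mapping.keys p) = p" for p :: laurent
      using laurent_sum[of p] by simp
    show "Poly_Mapping.keys (sum lmonom K) = K" if "K \<in> Pow A" for K
      using that finite_subset[OF _ assms] by (simp add: keys_sum_lmonom)
  qed
  show "finite (supported_on A)"
    using bij_betw_finite[OF bij] assms by simp
  show "card (supported_on A) = 2 ^ card A"
    using bij_betw_same_card[OF bij] assms by (simp add: card_Pow)
qed

subsection \<open>Finiteness of the quotient\<close>

definition add_subgroup :: "'a :: ab_group_add set \<Rightarrow> bool" where
  "add_subgroup G \<longleftrightarrow> 0 \<in> G \<and> (\<forall>x\<in>G. \<forall>y\<in>G. x - y \<in> G)"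

lemma add_subgroupD:
  assumes "add_subgroup G"
  shows "0 \<in> G" "x \<in> G \<Longrightarrow> y \<in> G \<Longrightarrow> x - y \<in> G" "x \<in> G \<Longrightarrow> y \<in> G \<Longrightarrow> x + y \<in> G"
proof -
  show *: "0 \<in> G" "x \<in> G \<Longrightarrow> y \<in> G \<Longrightarrow> x - y \<in> G" for x y
    using assms by (auto simp: add_subgroup_def)
  show "x \<in> G \<Longrightarrow> y \<in> G \<Longrightarrow> x + y \<in> G"
    using *(2)[of x "0 - y"] *(2)[of 0 y] *(1) by simp
qed

text \<open>The fibres of \<open>\<phi>\<close> on \<open>B\<close> are translates of
  \<open>B \<inter> K\<close>. Asking only for the fibres of a homomorphism admits coset maps with
  an arbitrary codomain.\<close>

lemma card_image_subgroup:
  assumes "finite B" "add_subgroup B"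
    and \<phi>: "\<And>a b. a \<in> B \<Longrightarrow> b \<in> B \<Longrightarrow> \<phi> a = \<phi> b \<longleftrightarrow> a - b \<in> K"
  shows "card B = card (\<phi> ` B) * card (B \<inter> K)"
proof -
  note B = add_subgroupD[OF assms(2)]
  have fibre: "card {b \<in> B. \<phi> b = \<phi> b0} = card (B \<inter> K)" if b0: "b0 \<in> B" for b0
  proof -
    have "{b \<in> B. \<phi> b = \<phi> b0} = (+) b0 ` (B \<inter> K)"
    proof (intro equalityI subsetI)
      fix b assume "b \<in> {b \<in> B. \<phi> b = \<phi> b0}"
      then have "b - b0 \<in> B \<inter> K" using \<phi> b0 B by auto
      then show "b \<in> (+) b0 ` (B \<inter> K)" by (intro image_eqI[of _ _ "b - b0"]) auto
    next
      fix b assume "b \<in> (+) b0 ` (B \<inter> K)"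
      then obtain k where "k \<in> B" "k \<in> K" "b = b0 + k" by auto
      then show "b \<in> {b \<in> B. \<phi> b = \<phi> b0}" using \<phi>[of b b0] b0 B by auto
    qed
    then show ?thesis by (simp add: card_image)
  qed
  have "card B = (\<Sum>y\<in>\<phi> ` B. card {b \<in> B. \<phi> b = y})"
    using sum.image_gen[OF assms(1), of "\<lambda>_. 1 :: nat" \<phi>] by simp
  also have "\<dots> = (\<Sum>y\<in>\<phi> ` B. card (B \<inter> K))"
    by (rule sum.cong) (use fibre in auto)
  finally show ?thesis by simp
qed

lemma add_subgroup_supported_on: "add_subgroup (supported_on A)"
proof -
  have "p - q \<in> supported_on A" if "p \<in> supported_on A" "q \<in> supported_on A" for p q
    using keys_diff[of p q] that unfolding supported_on_def by blast
  moreover have "0 \<in> supported_on A"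
    unfolding supported_on_def by simp
  ultimately show ?thesis
    unfolding add_subgroup_def by blast
qed

text \<open>The maxima of \<open>u\<close> over the two supports add up to a value attained on the
  support of the product. With \<open>u\<close> a signed coordinate, this bounds the extent of an
  unknown factor \<open>s\<close>.\<close>

lemma keys_factor_bound:
  fixes s h :: laurent and u v :: "int \<times> int \<Rightarrow> int"
  assumes u: "\<And>a b. u (a + b) = u a + u b" and v: "\<And>a b. v (a + b) = v a + v b"
    and inj: "inj (\<lambda>e. (u e, v e))"
    and bound: "\<And>c. c \<in> Poly_Mapping.keys (s * h) \<Longrightarrow> u c \<le> m"
    and xe: "x \<in> Poly_Mapping.keys s" "e \<in> Poly_Mapping.keys h"
  shows "u x + u e \<le> m"
proof -
  have "s \<noteq> 0" "h \<noteq> 0" using xe by auto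
  then obtain a b where ab: "a + b \<in> Poly_Mapping.keys (s * h)"
      "\<forall>x\<in>Poly_Mapping.keys s. u x \<le> u a" "\<forall>x\<in>Poly_Mapping.keys h. u x \<le> u b"
    using keys_mult_extremal[of s h u v, OF _ _ u v inj] by blast
  have "u x + u e \<le> u a + u b" using ab xe by (intro add_mono) auto
  also have "\<dots> \<le> m" using bound[OF ab(1)] u by simp
  finally show ?thesis .
qed

definition box :: "int \<Rightarrow> int \<Rightarrow> int \<Rightarrow> int \<Rightarrow> (int \<times> int) set" where
  "box a b c d = {a..<b} \<times> {c..<d}"

lemma card_box: "finite (box a b c d)" "card (box a b c d) = nat (b - a) * nat (d - c)"
  by (simp_all add: box_def)

lemma mult_supported_on:
  assumes "p \<in> supported_on A" "q \<in> supported_on B"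
    and "\<And>a b. a \<in> A \<Longrightarrow> b \<in> B \<Longrightarrow> a + b \<in> C"
  shows "p * q \<in> supported_on C"
  using assms keys_mult[of p q] by (fastforce simp: supported_on_def)

text \<open>The pairs from \<open>Q \<times> Q\<close> are counted by their image \<open>W\<close>,
  which lies in \<open>C \<inter> I\<close>, and by their syzygies, whose multipliers lie in
  \<open>S\<close>. The conditions on \<open>n\<close> keep the sides of the box for
  \<open>S\<close> from being negative.\<close>

lemma card_coset_image_le:
  fixes f g :: laurent and \<phi> :: "laurent \<Rightarrow> 'b"
  assumes syz: "\<And>a b. a * g + b * f = 0 \<Longrightarrow> \<exists>s. a = s * f \<and> b = s * g"
    and \<phi>: "\<And>a b. \<phi> a = \<phi> b \<longleftrightarrow> a - b \<in> I"
    and I: "\<And>a b. a * g + b * f \<in> I"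
    and keys: "\<And>e. e \<in> Poly_Mapping.keys f \<union> Poly_Mapping.keys g \<Longrightarrow>
      x0 \<le> fst e \<and> fst e \<le> x1 \<and> y0 \<le> snd e \<and> snd e \<le> y1"
    and attained: "x0 \<in> fst ` (Poly_Mapping.keys f \<union> Poly_Mapping.keys g)"
      "x1 \<in> fst ` (Poly_Mapping.keys f \<union> Poly_Mapping.keys g)"
      "y0 \<in> snd ` (Poly_Mapping.keys f \<union> Poly_Mapping.keys g)"
      "y1 \<in> snd ` (Poly_Mapping.keys f \<union> Poly_Mapping.keys g)"
    and n: "x1 - x0 \<le> 2 * n" "y1 - y0 \<le> 2 * n"
  shows "card (\<phi> ` supported_on (box (x0 - n) (x1 + n) (y0 - n) (y1 + n)))
    \<le> 2 ^ (2 * nat (x1 - x0) * nat (y1 - y0))"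
proof -
  define Q where "Q = supported_on (box (- n) n (- n) n)"
  define C where "C = supported_on (box (x0 - n) (x1 + n) (y0 - n) (y1 + n))"
  define S where "S = supported_on (box (- n - x0) (n - x1) (- n - y0) (n - y1))"
  define W where "W = (\<lambda>(a, b). a * g + b * f) ` (Q \<times> Q)"
  define K where "K = {(a, b). a * g + b * f = 0}"
  have pos: "x0 \<le> x1" "y0 \<le> y1"
    using attained(1,3) keys by (metis imageE order_trans)+
  have fin: "finite Q" "finite C" "finite S"
    by (simp_all add: Q_def C_def S_def card_supported_on card_box)
  have "Poly_Mapping.keys f \<union> Poly_Mapping.keys g \<subseteq> box x0 (x1 + 1) y0 (y1 + 1)"
  proof
    fix e assume "e \<in> Poly_Mapping.keys f \<union> Poly_Mapping.keys g"
    from keys[OF this] show "e \<in> box x0 (x1 + 1) y0 (y1 + 1)"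
      by (cases e) (auto simp: box_def)
  qed
  then have fg: "f \<in> supported_on (box x0 (x1 + 1) y0 (y1 + 1))"
      "g \<in> supported_on (box x0 (x1 + 1) y0 (y1 + 1))"
    by (auto simp: supported_on_def)
  have "a * h \<in> C" if "a \<in> Q" "h = f \<or> h = g" for a h
  proof -
    have "h \<in> supported_on (box x0 (x1 + 1) y0 (y1 + 1))" using that fg by auto
    with that(1) show ?thesis
      unfolding Q_def C_def by (rule mult_supported_on) (auto simp: box_def)
  qed
  then have "W \<subseteq> C \<inter> I"
    using I add_subgroupD(3)[OF add_subgroup_supported_on] by (auto simp: W_def C_def)
  then have W: "card W \<le> card (C \<inter> I)"
    using fin by (intro card_mono) auto
  \<comment> \<open>Each of the four extreme coordinates of the joint support is attained in
    \<open>f\<close> or in \<open>g\<close>. Multiplying \<open>s\<close> by that one stays in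
    \<open>Q\<close>, which bounds \<open>s\<close> in the corresponding direction.\<close>
  have "s \<in> S" if s: "s * f \<in> Q" "s * g \<in> Q" for s
  proof -
    have sh: "e \<in> Poly_Mapping.keys f \<union> Poly_Mapping.keys g \<Longrightarrow>
      \<exists>h. e \<in> Poly_Mapping.keys h \<and> s * h \<in> Q" for e using s by auto
    have ext: "u x + u e \<le> n'"
      if e: "e \<in> Poly_Mapping.keys f \<union> Poly_Mapping.keys g" and x: "x \<in> Poly_Mapping.keys s"
        and uv: "\<And>a b. u (a + b) = u a + u b" "\<And>a b. v (a + b) = v a + v b"
        "inj (\<lambda>e. (u e, v e))"
        "\<And>c. c \<in> box (- n) n (- n) n \<Longrightarrow> u c \<le> n'"
      for x e n' and u v :: "int \<times> int \<Rightarrow> int"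
    proof -
      obtain h where h: "e \<in> Poly_Mapping.keys h" "s * h \<in> Q" using sh[OF e] by blast
      then have "Poly_Mapping.keys (s * h) \<subseteq> box (- n) n (- n) n"
        by (simp add: Q_def supported_on_def)
      then have "u c \<le> n'" if "c \<in> Poly_Mapping.keys (s * h)" for c
        using that by (intro uv(4)) auto
      from keys_factor_bound[where u = u and v = v, OF uv(1-3) this x h(1)] show ?thesis .
    qed
    have "x \<in> box (- n - x0) (n - x1) (- n - y0) (n - y1)" if x: "x \<in> Poly_Mapping.keys s" for x
    proof -
      obtain e0 where e0: "e0 \<in> Poly_Mapping.keys f \<union> Poly_Mapping.keys g" "fst e0 = x0"
        using attained(1) by blast
      obtain e1 where e1: "e1 \<in> Poly_Mapping.keys f \<union> Poly_Mapping.keys g" "fst e1 = x1"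
        using attained(2) by blast
      obtain e2 where e2: "e2 \<in> Poly_Mapping.keys f \<union> Poly_Mapping.keys g" "snd e2 = y0"
        using attained(3) by blast
      obtain e3 where e3: "e3 \<in> Poly_Mapping.keys f \<union> Poly_Mapping.keys g" "snd e3 = y1"
        using attained(4) by blast
      note e = e0 e1 e2 e3
      \<comment> \<open>The bounds alternate between \<open>n\<close> and \<open>n - 1\<close>
        because the box is half-open: coordinates run from \<open>- n\<close> to
        \<open>n - 1\<close>.\<close>
      have "- fst x + - fst e0 \<le> n"
        using e x by (intro ext[where v = snd and u = "\<lambda>e. - fst e"]) (auto simp: box_def inj_def)
      moreover have "fst x + fst e1 \<le> n - 1"
        using e x by (intro ext[where v = snd and u = fst]) (auto simp: box_def inj_def)
      moreover have "- snd x + - snd e2 \<le> n"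
        using e x by (intro ext[where v = fst and u = "\<lambda>e. - snd e"]) (auto simp: box_def inj_def)
      moreover have "snd x + snd e3 \<le> n - 1"
        using e x by (intro ext[where v = fst and u = snd]) (auto simp: box_def inj_def)
      ultimately show ?thesis
        using e by (cases x) (auto simp: box_def)
    qed
    then show ?thesis by (auto simp: S_def supported_on_def)
  qed
  note S = this
  have "(Q \<times> Q) \<inter> K \<subseteq> (\<lambda>s. (s * f, s * g)) ` S"
  proof (intro subsetI)
    fix z assume z: "z \<in> (Q \<times> Q) \<inter> K"
    then obtain s where "z = (s * f, s * g)"
      using syz[of "fst z" "snd z"] by (cases z) (auto simp: K_def)
    with z S show "z \<in> (\<lambda>s. (s * f, s * g)) ` S" by auto
  qed
  then have K: "card ((Q \<times> Q) \<inter> K) \<le> card S"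
    using fin by (meson surj_card_le)
  have QQ: "add_subgroup (Q \<times> Q)"
    using add_subgroup_supported_on[of "box (- n) n (- n) n"]
    by (auto simp: add_subgroup_def Q_def zero_prod_def)
  have "card (Q \<times> Q) = card W * card ((Q \<times> Q) \<inter> K)"
    unfolding W_def using fin QQ
  proof (intro card_image_subgroup)
    fix p q :: "laurent \<times> laurent"
    obtain a b c d where "p = (a, b)" "q = (c, d)" by (cases p, cases q)
    moreover have "(a - c) * g + (b - d) * f = a * g + b * f - (c * g + d * f)"
      by (simp only: left_diff_distrib add_diff_add)
    ultimately show "(case p of (a, b) \<Rightarrow> a * g + b * f) = (case q of (a, b) \<Rightarrow> a * g + b * f)
        \<longleftrightarrow> p - q \<in> K"
      by (simp add: K_def)
  qed auto
  then have "card (Q \<times> Q) * card (\<phi> ` C) = card W * card (\<phi> ` C) * card ((Q \<times> Q) \<inter> K)"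
    by simp
  also have "\<dots> \<le> card (C \<inter> I) * card (\<phi> ` C) * card S"
    using W K by (intro mult_mono) auto
  also have "card (C \<inter> I) * card (\<phi> ` C) = card C"
    using card_image_subgroup[of C \<phi> I] fin \<phi> by (simp add: C_def add_subgroup_supported_on)
  finally have main: "card (Q \<times> Q) * card (\<phi> ` C) \<le> card C * card S" .
  define N where "N = nat (2 * n)"
  define dx where "dx = nat (x1 - x0)"
  define dy where "dy = nat (y1 - y0)"
  have le: "dx \<le> N" "dy \<le> N" using n by (auto simp: N_def dx_def dy_def)
  have "n \<ge> 0" using n pos by auto
  have side: "nat (n - - n) = N" "nat (x1 + n - (x0 - n)) = N + dx" "nat (y1 + n - (y0 - n)) = N + dy"
    "nat (n - x1 - (- n - x0)) = N - dx" "nat (n - y1 - (- n - y0)) = N - dy"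
    using pos \<open>n \<ge> 0\<close> n unfolding N_def dx_def dy_def by linarith+
  have cards: "card (Q \<times> Q) = 2 ^ (N * N + N * N)" "card C = 2 ^ ((N + dx) * (N + dy))"
    "card S = 2 ^ ((N - dx) * (N - dy))"
    by (simp_all only: Q_def C_def S_def card_cartesian_product card_supported_on card_box side
        power_add)
  \<comment> \<open>The linear terms in \<open>N\<close> cancel, which makes the final bound
    independent of the box. The identity is checked over the integers, where \<open>le\<close> makes
    the subtractions exact.\<close>
  have exps: "(N + dx) * (N + dy) + (N - dx) * (N - dy) = N * N + N * N + 2 * dx * dy"
  proof -
    have "int ((N + dx) * (N + dy) + (N - dx) * (N - dy)) = int (N * N + N * N + 2 * dx * dy)"
      by (simp only: of_nat_add of_nat_mult of_nat_diff[OF le(1)] of_nat_diff[OF le(2)] of_nat_numeral)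
        (simp add: algebra_simps)
    then show ?thesis by (simp only: of_nat_eq_iff)
  qed
  have "2 ^ (N * N + N * N) * card (\<phi> ` C) \<le> 2 ^ (N * N + N * N) * 2 ^ (2 * dx * dy)"
    using main unfolding cards by (simp only: exps flip: power_add)
  then have "card (\<phi> ` C) \<le> 2 ^ (2 * dx * dy)" by simp
  then show ?thesis by (simp only: C_def dx_def dy_def)
qed

text \<open>Any finitely many cosets have representatives in one common box, and the bound for boxes
  is uniform. So all finite subsets of the range have bounded size.\<close>

lemma finite_range_coset:
  fixes f g :: laurent and \<phi> :: "laurent \<Rightarrow> 'b"
  assumes TO: "topological_order f g"
    and \<phi>: "\<And>a b. \<phi> a = \<phi> b \<longleftrightarrow> a - b \<in> I"
    and I: "\<And>a b. a * g + b * f \<in> I"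
  shows "finite (range \<phi>)"
proof -
  let ?K = "Poly_Mapping.keys f \<union> Poly_Mapping.keys g"
  have K: "finite ?K" "?K \<noteq> {}" using topological_order_nonzero[OF TO] by auto
  define x0 x1 y0 y1 where defs: "x0 = Min (fst ` ?K)" "x1 = Max (fst ` ?K)"
    "y0 = Min (snd ` ?K)" "y1 = Max (snd ` ?K)"
  let ?m = "2 * nat (x1 - x0) * nat (y1 - y0)"
  have "card G \<le> 2 ^ ?m" if G: "G \<subseteq> range \<phi>" "finite G" for G
  proof -
    obtain P where P: "finite P" "G = \<phi> ` P" using G by (metis finite_subset_image)
    define E where "E = (\<Union>p\<in>P. Poly_Mapping.keys p)"
    have "finite E" using P by (simp add: E_def)
    \<comment> \<open>Large enough for the box to contain all chosen representatives and for
      \<open>2 * n\<close> to exceed both extents. The summand 1 gives the strict inequality needed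
      at the open ends of the box.\<close>
    define n where "n = \<bar>x0\<bar> + \<bar>x1\<bar> + \<bar>y0\<bar> + \<bar>y1\<bar> + (\<Sum>e\<in>E. \<bar>fst e\<bar> + \<bar>snd e\<bar>) + 1"
    have E: "\<bar>fst e\<bar> + \<bar>snd e\<bar> + \<bar>x0\<bar> + \<bar>x1\<bar> + \<bar>y0\<bar> + \<bar>y1\<bar> < n" if "e \<in> E" for e
      using member_le_sum[OF that, of "\<lambda>e. \<bar>fst e\<bar> + \<bar>snd e\<bar>"] \<open>finite E\<close> by (auto simp: n_def)
    have n: "\<bar>x0\<bar> + \<bar>x1\<bar> + \<bar>y0\<bar> + \<bar>y1\<bar> \<le> n"
      by (auto simp: n_def intro!: sum_nonneg)
    let ?C = "supported_on (box (x0 - n) (x1 + n) (y0 - n) (y1 + n))"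
    have "P \<subseteq> ?C"
    proof
      fix p assume p: "p \<in> P"
      have "e \<in> box (x0 - n) (x1 + n) (y0 - n) (y1 + n)" if "e \<in> Poly_Mapping.keys p" for e
      proof -
        have "\<bar>fst e\<bar> + \<bar>snd e\<bar> + \<bar>x0\<bar> + \<bar>x1\<bar> + \<bar>y0\<bar> + \<bar>y1\<bar> < n"
          by (rule E) (use p that in \<open>auto simp: E_def\<close>)
        then show ?thesis by (cases e) (auto simp: box_def)
      qed
      then show "p \<in> ?C" by (auto simp: supported_on_def)
    qed
    then have "card G \<le> card (\<phi> ` ?C)"
      unfolding P(2) by (intro card_mono finite_imageI image_mono card_supported_on card_box)
    also have "\<dots> \<le> 2 ^ ?m"
    proof (rule card_coset_image_le[where f = f and g = g and I = I])
      show "x0 \<le> fst e \<and> fst e \<le> x1 \<and> y0 \<le> snd e \<and> snd e \<le> y1" if "e \<in> ?K" for e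
        using that K by (auto simp: defs)
      show "x0 \<in> fst ` ?K" "x1 \<in> fst ` ?K" "y0 \<in> snd ` ?K" "y1 \<in> snd ` ?K"
        unfolding defs using K by (auto intro!: Min_in Max_in simp del: image_Un)
    qed (use topological_order_syzygy[OF TO] \<phi> I n in auto)
    finally show ?thesis .
  qed
  then show ?thesis by (metis finite_if_finite_subsets_card_bdd)
qed

subsection \<open>Cardinalities, duality and ideals\<close>

lemma (in vectorspace) card_carrier_eq_power_dim:
  assumes "finite (carrier V)"
  shows "card (carrier V) = card (carrier K) ^ dim"
proof -
  \<comment> \<open>The finite carrier is itself a finite spanning set.\<close>
  have "fin_dim"
    unfolding fin_dim_def using assms in_own_span[of "carrier V"] span_is_subset2[of "carrier V"]
    by blast
  then obtain b where b: "finite b" "basis b"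
    using finite_basis_exists by blast
  then have bV: "b \<subseteq> carrier V" by (simp add: basis_def)
  have "bij_betw (\<lambda>a. lincomb a b) (b \<rightarrow>\<^sub>E carrier K) (carrier V)"
    unfolding bij_betw_def
  proof
    have ex1: "\<exists>!a. a \<in> b \<rightarrow>\<^sub>E carrier K \<and> lincomb a b = v" if "v \<in> carrier V" for v
      using basis_criterion[OF b(1) bV] b(2) that by blast
    have closed: "lincomb a b \<in> carrier V" if "a \<in> b \<rightarrow>\<^sub>E carrier K" for a
      using that by (intro lincomb_closed bV) auto
    show "inj_on (\<lambda>a. lincomb a b) (b \<rightarrow>\<^sub>E carrier K)"
    proof (rule inj_onI)
      fix a a' assume a: "a \<in> b \<rightarrow>\<^sub>E carrier K" "a' \<in> b \<rightarrow>\<^sub>E carrier K"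
        "lincomb a b = lincomb a' b"
      obtain c where c: "\<And>y. y \<in> b \<rightarrow>\<^sub>E carrier K \<and> lincomb y b = lincomb a b \<Longrightarrow> y = c"
        using ex1[OF closed[OF a(1)]] by (elim ex1E) iprover
      have "a = c" by (rule c) (simp add: a(1))
      moreover have "a' = c" by (rule c) (simp add: a(2,3))
      ultimately show "a = a'" by simp
    qed
    show "(\<lambda>a. lincomb a b) ` (b \<rightarrow>\<^sub>E carrier K) = carrier V"
    proof (intro equalityI subsetI)
      fix v assume "v \<in> carrier V"
      from ex1[OF this] obtain a where "a \<in> b \<rightarrow>\<^sub>E carrier K" "lincomb a b = v"
        by (elim ex1E) iprover
      then show "v \<in> (\<lambda>a. lincomb a b) ` (b \<rightarrow>\<^sub>E carrier K)" by (intro image_eqI) simp_all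
    qed (use closed in auto)
  qed
  then have "card (carrier V) = card (b \<rightarrow>\<^sub>E carrier K)"
    by (metis bij_betw_same_card)
  also have "\<dots> = card (carrier K) ^ dim"
    using b by (simp add: card_PiE dim_basis)
  finally show ?thesis .
qed

lemma card_carrier_bit_space:
  assumes "vectorspace \<F>\<^sub>2 V" "finite (carrier V)"
  shows "card (carrier V) = 2 ^ vectorspace.dim \<F>\<^sub>2 V"
proof -
  have "(UNIV :: bit set) = {0, 1}" using bit_cases by auto
  then have "card (UNIV :: bit set) = 2" by (metis card_2_iff zero_neq_one)
  then show ?thesis
    using vectorspace.card_carrier_eq_power_dim[OF assms] by simp
qed

text \<open>Orthogonality of characters: if \<open>h z = 1\<close> for some \<open>z\<close> in
  \<open>G\<close>, translation by \<open>z\<close> flips every sign, so the sum equals its own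
  negative.\<close>

lemma sum_sign_additive:
  fixes h :: "'a :: ab_group_add \<Rightarrow> bit"
  assumes "finite G" "add_subgroup G"
    and h: "\<And>x y. h (x + y) = h x + h y"
  shows "(\<Sum>x\<in>G. if h x = 0 then 1 else - 1 :: int) = (if \<forall>x\<in>G. h x = 0 then int (card G) else 0)"
proof (cases "\<forall>x\<in>G. h x = 0")
  case True
  then show ?thesis by simp
next
  case False
  then obtain z where z: "z \<in> G" "h z = 1" using bit_cases by blast
  let ?\<sigma> = "\<lambda>x. if h x = 0 then 1 else - 1 :: int"
  have shift: "?\<sigma> (x + z) = - ?\<sigma> x" for x
    using h[of x z] z(2) bit_cases[of "h x"] by auto
  have "(\<Sum>x\<in>G. ?\<sigma> x) = (\<Sum>x\<in>G. ?\<sigma> (x + z))"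
    by (rule sum.reindex_bij_witness[of _ "\<lambda>x. x + z" "\<lambda>x. x - z"])
      (use z(1) add_subgroupD[OF assms(2)] in auto)
  also have "\<dots> = - (\<Sum>x\<in>G. ?\<sigma> x)"
    by (simp only: shift sum_negf)
  finally have "(\<Sum>x\<in>G. ?\<sigma> x) = 0" by simp
  then show ?thesis by (simp only: False if_False)
qed

text \<open>The signs of \<open>\<beta> s j\<close> are summed over \<open>B\<close> and
  \<open>J\<close> in both orders. Summing over \<open>J\<close> first, only annihilating
  \<open>s\<close> contribute, each \<open>card J\<close>; summing over \<open>B\<close> first,
  nondegeneracy leaves only \<open>j = 0\<close>, which contributes \<open>card B\<close>.\<close>

lemma card_annihilator:
  fixes \<beta> :: "'a :: ab_group_add \<Rightarrow> 'a \<Rightarrow> bit"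
  assumes B: "finite B" "add_subgroup B" and J: "J \<subseteq> B" "add_subgroup J"
    and l: "\<And>x y z. \<beta> (x + y) z = \<beta> x z + \<beta> y z"
    and r: "\<And>x y z. \<beta> z (x + y) = \<beta> z x + \<beta> z y"
    and nondeg: "\<And>t. t \<in> B \<Longrightarrow> (\<And>s. s \<in> B \<Longrightarrow> \<beta> s t = 0) \<Longrightarrow> t = 0"
  shows "card J * card {s \<in> B. \<forall>j\<in>J. \<beta> s j = 0} = card B"
proof -
  let ?\<sigma> = "\<lambda>s j. if \<beta> s j = 0 then 1 else - 1 :: int"
  have fJ: "finite J" using B J finite_subset by blast
  have zero: "\<beta> s 0 = 0" for s
    using r[of s 0 0] by simp
  have "int (card J * card {s \<in> B. \<forall>j\<in>J. \<beta> s j = 0})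
      = (\<Sum>s\<in>B. if \<forall>j\<in>J. \<beta> s j = 0 then int (card J) else 0)"
    using B(1) by (simp add: sum.If_cases Int_def)
  also have "\<dots> = (\<Sum>s\<in>B. \<Sum>j\<in>J. ?\<sigma> s j)"
  proof (rule sum.cong)
    fix s
    show "(if \<forall>j\<in>J. \<beta> s j = 0 then int (card J) else 0) = (\<Sum>j\<in>J. ?\<sigma> s j)"
      by (rule sum_sign_additive[OF fJ J(2), of "\<beta> s", OF r, symmetric])
  qed simp
  also have "\<dots> = (\<Sum>j\<in>J. \<Sum>s\<in>B. ?\<sigma> s j)"
    by (rule sum.swap)
  also have "\<dots> = (\<Sum>j\<in>J. if j = 0 then int (card B) else 0)"
  proof (rule sum.cong)
    fix j assume "j \<in> J"
    then have "(\<forall>s\<in>B. \<beta> s j = 0) \<longleftrightarrow> j = 0"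
      using nondeg[of j] zero J(1) by auto
    then show "(\<Sum>s\<in>B. ?\<sigma> s j) = (if j = 0 then int (card B) else 0)"
      using sum_sign_additive[OF B, of "\<lambda>s. \<beta> s j", OF l] by simp
  qed simp
  also have "\<dots> = int (card B)"
    using fJ add_subgroupD(1)[OF J(2)] by simp
  finally show ?thesis by (simp only: of_nat_eq_iff)
qed

section \<open>Ideals and cosets of the Laurent polynomial ring\<close>

lemma laurent_idealI:
  fixes I :: "laurent set"
  assumes "0 \<in> I" "\<And>p q. p \<in> I \<Longrightarrow> q \<in> I \<Longrightarrow> p + q \<in> I" "\<And>p q. q \<in> I \<Longrightarrow> p * q \<in> I"
  shows "ideal I R"
proof (rule idealI)
  show "ring R" by (rule class_ring.ring_axioms)
  show "subgroup I (add_monoid R)"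
  proof (rule group.subgroupI)
    show "group (add_monoid R)"
      by (rule abelian_group.a_group) (rule ring.axioms(1), rule class_ring.ring_axioms)
    fix p assume "p \<in> I"
    then have "- p \<in> I" using assms(3)[of p "- 1"] by simp
    moreover have "inv\<^bsub>add_monoid R\<^esub> p = - p"
      using class_ring_simps(8)[where 'a = laurent] by (simp add: a_inv_def fun_eq_iff)
    ultimately show "inv\<^bsub>add_monoid R\<^esub> p \<in> I" by simp
  qed (use assms in auto)
qed (use assms in \<open>auto simp: mult.commute\<close>)

lemma laurent_idealD:
  assumes "ideal I R"
  shows "0 \<in> I" "p \<in> I \<Longrightarrow> q \<in> I \<Longrightarrow> p + q \<in> I" "q \<in> I \<Longrightarrow> p * q \<in> I"
    "p \<in> I \<Longrightarrow> q \<in> I \<Longrightarrow> p - q \<in> I"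
proof -
  interpret ideal I R by fact
  show *: "0 \<in> I" "\<And>p q. p \<in> I \<Longrightarrow> q \<in> I \<Longrightarrow> p + q \<in> I" "\<And>p q. q \<in> I \<Longrightarrow> p * q \<in> I"
    using additive_subgroup.zero_closed[OF is_additive_subgroup]
      additive_subgroup.a_closed[OF is_additive_subgroup] I_l_closed by auto
  show "p \<in> I \<Longrightarrow> q \<in> I \<Longrightarrow> p - q \<in> I"
    using *(2)[of p "- 1 * q"] *(3)[of q "- 1"] by simp
qed

lemma add_subgroup_ideal: "ideal I R \<Longrightarrow> add_subgroup I"
  by (simp add: add_subgroup_def laurent_idealD)

lemma coset_eq_iff:
  assumes "ideal I R"
  shows "I +>\<^bsub>R\<^esub> a = I +>\<^bsub>R\<^esub> b \<longleftrightarrow> a - b \<in> I"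
  using ring.quotient_eq_iff_same_a_r_cos[OF class_ring.ring_axioms assms, of a b]
    class_ring_simps(9)[where 'a = laurent] by (simp add: fun_eq_iff)

lemma carrier_Quot: "carrier (R Quot I) = range (\<lambda>p. I +>\<^bsub>R\<^esub> p)"
  by (auto simp: FactRing_def A_RCOSETS_def')

lemma ideal_Idl: "ideal (Idl\<^bsub>R\<^esub> S) R"
  by (rule ring.genideal_ideal) (auto intro: class_ring.ring_axioms)

lemma subset_Idl: "S \<subseteq> Idl\<^bsub>R\<^esub> S"
  by (rule ring.genideal_self) (auto intro: class_ring.ring_axioms)

lemma Idl_subset: "ideal I R \<Longrightarrow> S \<subseteq> I \<Longrightarrow> Idl\<^bsub>R\<^esub> S \<subseteq> I"
  by (rule ring.genideal_minimal) (auto intro: class_ring.ring_axioms)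

subsection \<open>The code on a torus\<close>

text \<open>The map sending \<open>\<phi> p\<close> to \<open>\<psi> (h p)\<close> is well defined
  and injective by \<open>iff\<close>, and onto since \<open>h\<close> is surjective.\<close>

lemma card_range_eq:
  assumes iff: "\<And>p q. \<phi> p = \<phi> q \<longleftrightarrow> \<psi> (h p) = \<psi> (h q)" and "surj h"
  shows "card (range \<phi>) = card (range \<psi>)"
proof -
  let ?k = "\<lambda>c. \<psi> (h (inv_into UNIV \<phi> c))"
  have k: "?k (\<phi> p) = \<psi> (h p)" for p
    by (rule iff[THEN iffD1]) (rule f_inv_into_f[OF rangeI])
  have "inj_on ?k (range \<phi>)"
    by (rule inj_onI) (use k iff in auto)
  then have "card (range \<phi>) = card (?k ` range \<phi>)" by (simp add: card_image)
  also have "?k ` range \<phi> = range \<psi>"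
  proof -
    have "?k ` range \<phi> = \<psi> ` range h" by (simp only: image_image k)
    then show ?thesis by (simp only: \<open>surj h\<close>)
  qed
  finally show ?thesis .
qed

locale torus =
  fixes Lx Ly :: nat
  assumes pos: "Lx \<ge> 1" "Ly \<ge> 1"
begin

abbreviation T :: "laurent set" where "T \<equiv> torus_ideal Lx Ly"

definition wrap :: "int \<times> int \<Rightarrow> int \<times> int" where
  "wrap e = (fst e mod int Lx, snd e mod int Ly)"

definition cells :: "(int \<times> int) set" where
  "cells = box 0 (int Lx) 0 (int Ly)"

text \<open>A normal form modulo \<open>T\<close>: the polynomials supported on \<open>cells\<close>
  serve as a concrete copy of the group algebra \<open>S\<close> of the torus.\<close>

definition fold_torus :: "laurent \<Rightarrow> laurent" where
  "fold_torus p = (\<Sum>e\<in>Poly_Mapping.keys p. Poly_Mapping.single (wrap e) (Poly_Mapping.lookup p e))"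

lemma wrap_wrap: "wrap (c + wrap e) = wrap (c + e)"
  by (simp add: wrap_def mod_add_right_eq)

lemma wrap_cells: "wrap e \<in> cells" "e \<in> cells \<Longrightarrow> wrap e = e"
  using pos by (auto simp: wrap_def cells_def box_def mem_Times_iff)

lemma wrap_diff_eq_0_iff: "c \<in> cells \<Longrightarrow> wrap (- c + e) = 0 \<longleftrightarrow> wrap e = c"
  using pos
  by (cases c; cases e)
    (auto simp: wrap_def cells_def box_def zero_prod_def mod_eq_dvd_iff[symmetric]
      mod_0_imp_dvd dvd_imp_mod_0 mod_pos_pos_trivial)

lemma fold_torus_add: "fold_torus (p + q) = fold_torus p + fold_torus q"
  unfolding fold_torus_def by (rule setsum_keys_plus_distrib) (simp_all only: single_zero single_add)

lemma fold_torus_lmonom: "fold_torus (lmonom e) = lmonom (wrap e)"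
  by (simp add: fold_torus_def lmonom_def)

lemma fold_torus_0: "fold_torus 0 = 0"
  by (simp add: fold_torus_def)

lemma fold_torus_diff: "fold_torus (p - q) = fold_torus p - fold_torus q"
  using fold_torus_add[of "p - q" q] by simp

lemma fold_torus_mult: "fold_torus (p * fold_torus q) = fold_torus (p * q)"
proof (rule additive_ext[where F = "\<lambda>q. fold_torus (p * fold_torus q)"])
  fix c
  show "fold_torus (p * fold_torus (lmonom c)) = fold_torus (p * lmonom c)"
    by (rule additive_ext[where F = "\<lambda>p. fold_torus (p * fold_torus (lmonom c))"
          and G = "\<lambda>p. fold_torus (p * lmonom c)"])
      (simp_all add: fold_torus_add distrib_right fold_torus_lmonom lmonom_mult wrap_wrap)
qed (simp_all add: fold_torus_add distrib_left)

lemma fold_torus_supported_on: "fold_torus p \<in> supported_on cells"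
proof -
  have "Poly_Mapping.keys (fold_torus p) \<subseteq>
      (\<Union>e\<in>Poly_Mapping.keys p. Poly_Mapping.keys (Poly_Mapping.single (wrap e) (Poly_Mapping.lookup p e)))"
    unfolding fold_torus_def by (rule keys_sum)
  also have "\<dots> \<subseteq> cells" using wrap_cells(1) by (auto split: if_splits)
  finally show ?thesis by (simp add: supported_on_def)
qed

lemma fold_torus_id: "p \<in> supported_on cells \<Longrightarrow> fold_torus p = p"
proof -
  assume p: "p \<in> supported_on cells"
  have "fold_torus p = (\<Sum>e\<in>Poly_Mapping.keys p. lmonom e)"
    unfolding fold_torus_def
  proof (rule sum.cong)
    fix e assume e: "e \<in> Poly_Mapping.keys p"
    then have "Poly_Mapping.lookup p e = 1"
      using bit_cases[of "Poly_Mapping.lookup p e"] by (auto simp: in_keys_iff)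
    moreover have "wrap e = e" using e p wrap_cells(2)[of e] unfolding supported_on_def by blast
    ultimately show "Poly_Mapping.single (wrap e) (Poly_Mapping.lookup p e) = lmonom e"
      by (simp add: lmonom_def)
  qed simp
  then show ?thesis using laurent_sum[of p] by simp
qed

text \<open>Translation makes every coefficient on the torus a constant coefficient. This is the
  source of nondegeneracy of the pairing below.\<close>

lemma lookup_fold_torus:
  assumes "c \<in> cells"
  shows "Poly_Mapping.lookup (fold_torus (lmonom (- c) * p)) 0 = Poly_Mapping.lookup (fold_torus p) c"
proof (rule additive_ext[where F = "\<lambda>p. Poly_Mapping.lookup (fold_torus (lmonom (- c) * p)) 0"
      and G = "\<lambda>p. Poly_Mapping.lookup (fold_torus p) c"])
  fix e
  show "Poly_Mapping.lookup (fold_torus (lmonom (- c) * lmonom e)) 0 =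
      Poly_Mapping.lookup (fold_torus (lmonom e)) c"
    using wrap_diff_eq_0_iff[OF assms, of e]
    by (simp only: lmonom_mult fold_torus_lmonom) (simp add: lmonom_def lookup_single when_def)
qed (simp_all add: fold_torus_add distrib_left lookup_add)

text \<open>Stated for any ideal containing the torus relations, so that it serves both
  \<open>T\<close> and \<open>code_ideal\<close>.\<close>

lemma lmonom_diff_mem:
  assumes "ideal I R" "X ^ Lx - 1 \<in> I" "Y ^ Ly - 1 \<in> I"
  shows "lmonom e - lmonom (wrap e) \<in> I"
proof -
  note I = laurent_idealD[OF assms(1)]
  have nat: "u ^ (k * n) - 1 \<in> I" if "u ^ n - 1 \<in> I" for u :: laurent and k n
  proof -
    obtain q where "(u ^ n) ^ k - 1 = (u ^ n - 1) * q"
      using power_diff_1_eq[of "u ^ n" k] by blast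
    then have "u ^ (k * n) - 1 = q * (u ^ n - 1)"
      by (simp only: mult.commute[of k n] power_mult mult.commute[of q])
    then show ?thesis using I(3)[OF that, of q] by simp
  qed
  have int: "lmonom (k * a, k * b) - 1 \<in> I" if "lmonom (a, b) - 1 \<in> I" for a b k
  proof (cases "k \<ge> 0")
    case True
    then show ?thesis using nat[of "lmonom (a, b)" 1 "nat k"] that by (simp add: lmonom_power)
  next
    case False
    then have "lmonom (- k * a, - k * b) - 1 \<in> I"
      using nat[of "lmonom (a, b)" 1 "nat (- k)"] that by (simp add: lmonom_power)
    \<comment> \<open>For a negative exponent, the relation for the inverse is multiplied by a
      unit.\<close>
    from I(3)[OF this, of "- lmonom (k * a, k * b)"]
    show ?thesis
      by (simp add: right_diff_distrib lmonom_mult lmonom_0[unfolded zero_prod_def])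
  qed
  obtain i j where e: "e = (i, j)" by (cases e)
  define k l where "k = i div int Lx" and "l = j div int Ly"
  have ij: "k * int Lx + i mod int Lx = i" "l * int Ly + j mod int Ly = j"
    by (simp_all add: k_def l_def)
  have "lmonom (k * int Lx, 0) - 1 \<in> I" "lmonom (0, l * int Ly) - 1 \<in> I"
    using assms(2,3) int[of "int Lx" 0 k] int[of 0 "int Ly" l] by (simp_all add: lmonom_power)
  \<comment> \<open>Writing \<open>e\<close> as \<open>wrap e\<close> plus \<open>k\<close> and
    \<open>l\<close> full turns, the difference telescopes: first the turns in x, then those in
    y.\<close>
  then have "lmonom (wrap e) * (lmonom (0, l * int Ly) * (lmonom (k * int Lx, 0) - 1)
      + (lmonom (0, l * int Ly) - 1)) \<in> I"
    by (intro I(2,3))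
  also have "lmonom (wrap e) * (lmonom (0, l * int Ly) * (lmonom (k * int Lx, 0) - 1)
      + (lmonom (0, l * int Ly) - 1)) = lmonom e - lmonom (wrap e)"
    using ij by (simp add: e wrap_def distrib_left right_diff_distrib lmonom_mult add.commute)
  finally show ?thesis .
qed

lemma diff_fold_torus_mem:
  assumes "ideal I R" "X ^ Lx - 1 \<in> I" "Y ^ Ly - 1 \<in> I"
  shows "p - fold_torus p \<in> I"
proof -
  note I = laurent_idealD[OF assms(1)]
  have "sum lmonom K - fold_torus (sum lmonom K) \<in> I" if "finite K" for K
    using that
  proof induction
    case empty
    then show ?case using I(1) by (simp add: fold_torus_0)
  next
    case (insert e K)
    have "sum lmonom (insert e K) - fold_torus (sum lmonom (insert e K)) =
        (lmonom e - lmonom (wrap e)) + (sum lmonom K - fold_torus (sum lmonom K))"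
      using insert by (simp add: fold_torus_add fold_torus_lmonom)
    then show ?case using I(2)[OF lmonom_diff_mem[OF assms, of e] insert.IH] by simp
  qed
  from this[of "Poly_Mapping.keys p"] show ?thesis
    using laurent_sum[of p] by simp
qed

text \<open>Being an ideal, this set contains a generated ideal as soon as it contains the
  generators.\<close>

lemma ideal_annihilates: "ideal {p. fold_torus (s * p) = 0} R"
proof (rule laurent_idealI)
  fix p q assume "q \<in> {p. fold_torus (s * p) = 0}"
  then have "fold_torus (p * (s * q)) = 0"
    using fold_torus_mult[of p "s * q"] by (simp add: fold_torus_0)
  then show "p * q \<in> {p. fold_torus (s * p) = 0}" by (simp add: mult.left_commute)
qed (simp_all add: fold_torus_0 fold_torus_add distrib_left)

lemma fold_torus_generators:
  "fold_torus (s * (X ^ Lx - 1)) = 0" "fold_torus (s * (Y ^ Ly - 1)) = 0"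
proof -
  have "fold_torus (X ^ Lx - 1) = 0" "fold_torus (Y ^ Ly - 1) = 0"
    by (simp_all add: lmonom_power fold_torus_diff fold_torus_lmonom wrap_def flip: lmonom_0)
  then show "fold_torus (s * (X ^ Lx - 1)) = 0" "fold_torus (s * (Y ^ Ly - 1)) = 0"
    using fold_torus_mult[of s "X ^ Lx - 1"] fold_torus_mult[of s "Y ^ Ly - 1"]
    by (simp_all add: fold_torus_0)
qed

lemma torus_generators: "X ^ Lx - 1 \<in> T" "Y ^ Ly - 1 \<in> T"
  using subset_Idl[of "{X ^ Lx - 1, Y ^ Ly - 1}"] by (auto simp: torus_ideal_def)

lemma ideal_T: "ideal T R"
  by (simp add: torus_ideal_def ideal_Idl)

lemma mem_T_iff: "p \<in> T \<longleftrightarrow> fold_torus p = 0"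
proof
  have "T \<subseteq> {p. fold_torus (1 * p) = 0}"
    unfolding torus_ideal_def
    by (rule Idl_subset[OF ideal_annihilates]) (use fold_torus_generators[of 1] in simp)
  then show "p \<in> T \<Longrightarrow> fold_torus p = 0" by auto
  show "fold_torus p = 0 \<Longrightarrow> p \<in> T"
    using diff_fold_torus_mem[OF ideal_T torus_generators, of p] by simp
qed

text \<open>The preimage in \<open>R\<close> of the ideal of \<open>S\<close> generated by
  \<open>a\<close> and \<open>b\<close>; for \<open>f\<close> and \<open>g\<close> it is the
  \<open>J\<close> of the overview.\<close>

definition code_ideal :: "laurent \<Rightarrow> laurent \<Rightarrow> laurent set" where
  "code_ideal a b = Idl\<^bsub>R\<^esub> {a, b, X ^ Lx - 1, Y ^ Ly - 1}"

lemma code_ideal: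
  "ideal (code_ideal a b) R" "a \<in> code_ideal a b" "b \<in> code_ideal a b"
  "X ^ Lx - 1 \<in> code_ideal a b" "Y ^ Ly - 1 \<in> code_ideal a b"
  using subset_Idl[of "{a, b, X ^ Lx - 1, Y ^ Ly - 1}"] by (auto simp: code_ideal_def ideal_Idl)

text \<open>With the constant coefficient of a product on the torus as pairing, the orthogonal
  complement of \<open>code_ideal a b\<close> consists of the \<open>s\<close> killing both
  \<open>a\<close> and \<open>b\<close> in \<open>S\<close>. Then \<open>card_annihilator\<close>
  applies.\<close>

lemma card_code_ideal_annihilator:
  "card (supported_on cells \<inter> code_ideal a b) * card (supported_on cells \<inter> {s. s * a \<in> T \<and> s * b \<in> T})
    = 2 ^ (Lx * Ly)"
proof -
  let ?B = "supported_on cells" and ?J = "code_ideal a b"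
  let ?\<beta> = "\<lambda>s t. Poly_Mapping.lookup (fold_torus (s * t)) 0"
  note J = laurent_idealD[OF code_ideal(1)[of a b]]
  have fin: "finite ?B" "card ?B = 2 ^ (Lx * Ly)"
    by (simp_all add: cells_def card_box card_supported_on)
  have sub: "add_subgroup (?B \<inter> ?J)"
    using add_subgroupD[OF add_subgroup_supported_on[of cells]]
      add_subgroupD[OF add_subgroup_ideal[OF code_ideal(1)[of a b]]]
    unfolding add_subgroup_def by blast
  have "s * a \<in> T \<and> s * b \<in> T \<longleftrightarrow> (\<forall>j\<in>?B \<inter> ?J. ?\<beta> s j = 0)" for s
  proof
    assume "s * a \<in> T \<and> s * b \<in> T"
    then have "?J \<subseteq> {p. fold_torus (s * p) = 0}"
      unfolding code_ideal_def
      by (intro Idl_subset[OF ideal_annihilates]) (use fold_torus_generators in \<open>auto simp: mem_T_iff\<close>)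
    then show "\<forall>j\<in>?B \<inter> ?J. ?\<beta> s j = 0" by auto
  next
    assume ann: "\<forall>j\<in>?B \<inter> ?J. ?\<beta> s j = 0"
    have "fold_torus (s * j) = 0" if j: "j \<in> ?J" for j
    proof (rule poly_mapping_eqI)
      fix c
      show "Poly_Mapping.lookup (fold_torus (s * j)) c = Poly_Mapping.lookup 0 c"
      proof (cases "c \<in> cells")
        case True
        \<comment> \<open>Orthogonality controls only constant coefficients. Since the ideal is
          closed under translation, testing against the translate of \<open>j\<close> by
          \<open>- c\<close> gives the coefficient of \<open>s * j\<close> at
          \<open>c\<close>.\<close>
        let ?j = "fold_torus (lmonom (- c) * j)"
        have "lmonom (- c) * j - (lmonom (- c) * j - ?j) \<in> ?J"
          by (intro J(4) J(3) j diff_fold_torus_mem code_ideal)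
        then have "?j \<in> ?B \<inter> ?J" using fold_torus_supported_on by simp
        then have "?\<beta> s ?j = 0" using ann by blast
        then have "Poly_Mapping.lookup (fold_torus (lmonom (- c) * (s * j))) 0 = 0"
          by (simp only: fold_torus_mult mult.left_commute)
        then show ?thesis by (simp only: lookup_fold_torus[OF True] lookup_zero)
      next
        case False
        then have "c \<notin> Poly_Mapping.keys (fold_torus (s * j))"
          using fold_torus_supported_on[of "s * j"] by (auto simp: supported_on_def)
        then show ?thesis by (simp only: in_keys_iff not_not lookup_zero)
      qed
    qed
    then show "s * a \<in> T \<and> s * b \<in> T" by (simp add: mem_T_iff code_ideal)
  qed
  then have "?B \<inter> {s. s * a \<in> T \<and> s * b \<in> T} = {s \<in> ?B. \<forall>j\<in>?B \<inter> ?J. ?\<beta> s j = 0}"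
    by blast
  moreover have "card (?B \<inter> ?J) * card {s \<in> ?B. \<forall>j\<in>?B \<inter> ?J. ?\<beta> s j = 0} = card ?B"
  proof (rule card_annihilator)
    fix t assume t: "t \<in> ?B" and z: "\<And>s. s \<in> ?B \<Longrightarrow> ?\<beta> s t = 0"
    have "Poly_Mapping.lookup t c = 0" for c
    proof (cases "c \<in> cells")
      case True
      \<comment> \<open>Nondegeneracy: pairing with this wrapped monomial reads off the coefficient
        of \<open>t\<close> at \<open>c\<close>.\<close>
      have "?\<beta> (fold_torus (lmonom (- c))) t = 0"
        by (rule z) (rule fold_torus_supported_on)
      then have "Poly_Mapping.lookup (fold_torus (lmonom (- c) * t)) 0 = 0"
        by (simp only: fold_torus_mult mult.commute[of _ t])
      then show ?thesis by (simp only: lookup_fold_torus[OF True] fold_torus_id[OF t])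
    next
      case False
      then have "c \<notin> Poly_Mapping.keys t" using t by (auto simp: supported_on_def)
      then show ?thesis by (simp only: in_keys_iff not_not)
    qed
    then show "t = 0" by (intro poly_mapping_eqI) (simp only: lookup_zero)
  qed (use fin sub add_subgroup_supported_on in
      \<open>simp_all only: fold_torus_add distrib_left distrib_right lookup_add Int_lower1\<close>)
  ultimately show ?thesis using fin by simp
qed

lemma range_coset_eq:
  assumes "\<And>p q. \<phi> p = \<phi> q \<longleftrightarrow> p - q \<in> I" "ideal I R" "X ^ Lx - 1 \<in> I" "Y ^ Ly - 1 \<in> I"
  shows "range \<phi> = \<phi> ` supported_on cells"
proof -
  have "\<phi> p = \<phi> (fold_torus p)" for p
    using assms(1) diff_fold_torus_mem[OF assms(2-4)] by blast
  then show ?thesis using fold_torus_supported_on by blast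
qed

section \<open>Ranks of the stabilizer spaces\<close>

lemma carrier_stab_space:
  "carrier (stab_space T a b) = (\<lambda>p. (T +>\<^bsub>R\<^esub> (p * a), T +>\<^bsub>R\<^esub> (p * b))) ` supported_on cells"
proof -
  have mult: "(T +>\<^bsub>R\<^esub> p) \<otimes>\<^bsub>R Quot T\<^esub> (T +>\<^bsub>R\<^esub> q) = T +>\<^bsub>R\<^esub> (p * q)" for p q
    using ideal.rcoset_mult_add[OF ideal_T, of p q] by (simp add: FactRing_def)
  let ?\<phi> = "\<lambda>p. (T +>\<^bsub>R\<^esub> (p * a), T +>\<^bsub>R\<^esub> (p * b))"
  have "carrier (stab_space T a b) = range ?\<phi>"
    by (simp only: stab_space_def carrier_Quot setcompr_eq_image Collect_mem_eq image_image mult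
        partial_object.simps partial_object.update_convs) simp
  also have "\<dots> = ?\<phi> ` supported_on cells"
  proof -
    have "?\<phi> p = ?\<phi> (fold_torus p)" for p
    proof -
      have "(p - fold_torus p) * c \<in> T" for c
        using laurent_idealD(3)[OF ideal_T, of "p - fold_torus p" c]
          diff_fold_torus_mem[OF ideal_T torus_generators, of p] by (simp only: mult.commute)
      then show ?thesis
        by (simp only: coset_eq_iff[OF ideal_T] prod.inject flip: left_diff_distrib)
    qed
    then show ?thesis using fold_torus_supported_on by blast
  qed
  finally show ?thesis .
qed

text \<open>The kernel of \<open>s \<mapsto> (s a, s b)\<close> on the torus is the annihilator just
  counted. Cancelling its size shows that the stabilizer space is as large as the image of
  \<open>code_ideal a b\<close> in \<open>S\<close>, whose index is the size of the
  quotient.\<close>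

lemma card_stab_space:
  "2 ^ vectorspace.dim \<F>\<^sub>2 (stab_space T a b) * card (carrier (R Quot code_ideal a b))
    = (2 :: nat) ^ (Lx * Ly)"
proof -
  let ?B = "supported_on cells" and ?J = "code_ideal a b" and ?A = "{s. s * a \<in> T \<and> s * b \<in> T}"
  have fin: "finite ?B" "card ?B = 2 ^ (Lx * Ly)"
    by (simp_all add: cells_def card_box card_supported_on)
  have A: "card ?B = card (carrier (stab_space T a b)) * card (?B \<inter> ?A)"
    unfolding carrier_stab_space
    by (rule card_image_subgroup)
      (use fin add_subgroup_supported_on in
        \<open>simp_all add: coset_eq_iff[OF ideal_T] left_diff_distrib\<close>)
  moreover have "card ?B = card (?B \<inter> ?J) * card (?B \<inter> ?A)"
    by (simp only: card_code_ideal_annihilator fin)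
  moreover have "card (?B \<inter> ?A) \<noteq> 0"
  proof
    assume "card (?B \<inter> ?A) = 0"
    then have "card ?B = 0" by (simp only: A mult_0_right)
    then show False by (simp add: fin)
  qed
  ultimately have "card (carrier (stab_space T a b)) = card (?B \<inter> ?J)"
    by (simp only: mult_cancel2) simp
  moreover have "card (carrier (stab_space T a b)) = 2 ^ vectorspace.dim \<F>\<^sub>2 (stab_space T a b)"
    by (rule card_carrier_bit_space[OF stab_space_vectorspace[OF ideal_T]])
      (simp add: carrier_stab_space fin)
  moreover have "card ?B = card (carrier (R Quot ?J)) * card (?B \<inter> ?J)"
    unfolding carrier_Quot range_coset_eq[OF coset_eq_iff[OF code_ideal(1)] code_ideal(1,4,5)]
    by (rule card_image_subgroup) (use fin add_subgroup_supported_on in \<open>simp_all only: coset_eq_iff[OF code_ideal(1)]\<close>)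
  ultimately show ?thesis by (simp only: fin mult.commute)
qed

text \<open>The antipode is a ring homomorphism and maps each torus relation to a unit multiple of
  itself.\<close>

lemma antipode_code_ideal:
  assumes "p \<in> code_ideal a b"
  shows "antipode p \<in> code_ideal (antipode b) (antipode a)"
proof -
  let ?J = "code_ideal (antipode b) (antipode a)"
  note J = laurent_idealD[OF code_ideal(1)[of "antipode b" "antipode a"]]
  have "ideal {p. antipode p \<in> ?J} R"
    by (rule laurent_idealI) (simp_all add: antipode_add antipode_mult J)
  moreover have "antipode (X ^ Lx - 1) \<in> ?J" "antipode (Y ^ Ly - 1) \<in> ?J"
  proof -
    have one: "lmonom (0, 0) = 1" using lmonom_0 by (simp add: zero_prod_def)
    have "antipode (X ^ Lx - 1) = - lmonom (- int Lx, 0) * (X ^ Lx - 1)"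
      "antipode (Y ^ Ly - 1) = - lmonom (0, - int Ly) * (Y ^ Ly - 1)"
      by (simp_all add: antipode_diff lmonom_power antipode_lmonom right_diff_distrib lmonom_mult one
          flip: one)
    then show "antipode (X ^ Lx - 1) \<in> ?J" "antipode (Y ^ Ly - 1) \<in> ?J"
      by (simp_all only: J(3) code_ideal(4,5))
  qed
  ultimately have "code_ideal a b \<subseteq> {p. antipode p \<in> ?J}"
    unfolding code_ideal_def[of a b]
    by (intro Idl_subset) (use code_ideal(2)[of "antipode b" "antipode a"] code_ideal(3)[of "antipode a" "antipode b"] in auto)
  with assms show ?thesis by blast
qed

text \<open>The antipode is an involution, so it identifies the two quotients. Hence X- and
  Z-stabilizers have equal rank.\<close>

lemma card_Quot_antipode:
  "card (carrier (R Quot code_ideal (antipode b) (antipode a))) = card (carrier (R Quot code_ideal a b))"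
proof -
  let ?J = "code_ideal a b" and ?J' = "code_ideal (antipode b) (antipode a)"
  have iff: "antipode p \<in> ?J' \<longleftrightarrow> p \<in> ?J" for p
    using antipode_code_ideal[of p a b] antipode_code_ideal[of "antipode p" "antipode b" "antipode a"]
    by auto
  have "surj antipode" by (metis antipode_antipode surjI)
  then show ?thesis
    unfolding carrier_Quot
    by (intro card_range_eq[where h = antipode, symmetric])
      (simp_all only: coset_eq_iff[OF code_ideal(1)] iff flip: antipode_diff)
qed

lemma finite_Quot_code_ideal: "finite (carrier (R Quot code_ideal f g))"
  unfolding carrier_Quot range_coset_eq[OF coset_eq_iff[OF code_ideal(1)] code_ideal(1,4,5)]
  by (simp add: cells_def card_box card_supported_on)

text \<open>Each of the two ranks is \<open>Lx * Ly - ?d\<close>, which leaves \<open>2 * ?d\<close>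
  of the \<open>2 * Lx * Ly\<close> qubits.\<close>

lemma logical_dim_eq:
  "logical_dim f g Lx Ly = 2 * int (vectorspace.dim \<F>\<^sub>2 (quot_space (code_ideal f g)))"
proof -
  let ?d = "vectorspace.dim \<F>\<^sub>2 (quot_space (code_ideal f g))"
  have card: "card (carrier (R Quot code_ideal f g)) = 2 ^ ?d"
    using card_carrier_bit_space[OF quot_space_vectorspace[OF code_ideal(1)[of f g]]] finite_Quot_code_ideal[of f g]
    by (simp add: quot_space_def)
  have "vectorspace.dim \<F>\<^sub>2 (stab_space T f g) + ?d = Lx * Ly"
    using card_stab_space[of f g] by (simp add: card power_inject_exp flip: power_add)
  moreover have "vectorspace.dim \<F>\<^sub>2 (stab_space T (antipode g) (antipode f)) + ?d = Lx * Ly"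
    using card_stab_space[of "antipode g" "antipode f"]
    by (simp add: card_Quot_antipode card power_inject_exp flip: power_add)
  ultimately show ?thesis
    unfolding logical_dim_def mult.assoc of_nat_mult[symmetric] by linarith
qed

end

subsection \<open>Minimal lengths\<close>

text \<open>The canonical surjection from \<open>R/I\<close> to \<open>R/J\<close>, here
  \<open>?k\<close>, is a map between finite sets of equal size, hence injective; so its kernel
  \<open>J/I\<close> is trivial.\<close>

lemma card_coset_eq_imp_subset:
  assumes "ideal I R" "ideal J R" "I \<subseteq> J" and fin: "finite (carrier (R Quot I))"
    and card: "card (carrier (R Quot I)) = card (carrier (R Quot J))"
  shows "J \<subseteq> I"
proof
  fix p assume "p \<in> J"
  let ?i = "\<lambda>p. I +>\<^bsub>R\<^esub> p" and ?j = "\<lambda>p. J +>\<^bsub>R\<^esub> p"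
  let ?k = "\<lambda>c. ?j (inv_into UNIV ?i c)"
  have k: "?k (?i p) = ?j p" for p
  proof -
    have "?i (inv_into UNIV ?i (?i p)) = ?i p" by (rule f_inv_into_f[OF rangeI])
    then show ?thesis
      using assms(3) unfolding coset_eq_iff[OF assms(1)] coset_eq_iff[OF assms(2)] by blast
  qed
  have "card (?k ` range ?i) = card (range ?i)"
    using card unfolding carrier_Quot by (simp only: image_image k)
  then have inj: "inj_on ?k (range ?i)"
    using fin unfolding carrier_Quot by (rule eq_card_imp_inj_on[rotated])
  have "?j p = ?j 0"
    using \<open>p \<in> J\<close> by (simp only: coset_eq_iff[OF assms(2)] diff_zero)
  then have "?k (?i p) = ?k (?i 0)" by (simp only: k)
  then have "?i p = ?i 0" by (rule inj_onD[OF inj]) (rule rangeI)+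
  then show "p \<in> I" by (simp only: coset_eq_iff[OF assms(1)] diff_zero)
qed

text \<open>Two powers of \<open>u\<close> share a coset by the pigeonhole principle. Multiplying
  their difference by a power of the inverse \<open>v\<close> cancels the lower one.\<close>

lemma unit_power_diff_1_mem:
  fixes u v :: laurent
  assumes "ideal I R" "finite (carrier (R Quot I))" "u * v = 1"
  shows "\<exists>L>0. u ^ L - 1 \<in> I"
proof -
  have "finite (range (\<lambda>n. I +>\<^bsub>R\<^esub> (u ^ n)))"
    by (rule finite_subset[OF _ assms(2)]) (auto simp: carrier_Quot)
  then have "\<not> inj (\<lambda>n. I +>\<^bsub>R\<^esub> (u ^ n))"
    using finite_imageD infinite_UNIV_nat by blast
  then obtain m n where "m \<noteq> n" "I +>\<^bsub>R\<^esub> (u ^ m) = I +>\<^bsub>R\<^esub> (u ^ n)"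
    by (auto simp: inj_def)
  then obtain i j where ij: "i < j" "I +>\<^bsub>R\<^esub> (u ^ j) = I +>\<^bsub>R\<^esub> (u ^ i)"
    by (metis nat_neq_iff)
  then have "u ^ j - u ^ i \<in> I"
    by (simp only: coset_eq_iff[OF assms(1)])
  then have "v ^ i * (u ^ j - u ^ i) \<in> I"
    by (rule laurent_idealD(3)[OF assms(1)])
  also have "v ^ i * (u ^ j - u ^ i) = (u * v) ^ i * u ^ (j - i) - (u * v) ^ i"
  proof -
    have "u ^ j = u ^ i * u ^ (j - i)"
      using ij(1) by (simp flip: power_add)
    then show ?thesis
      by (simp only: right_diff_distrib power_mult_distrib mult_ac)
  qed
  finally have "u ^ (j - i) - 1 \<in> I" by (simp add: assms(3))
  with ij(1) show ?thesis by (intro exI[of _ "j - i"]) simp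
qed

lemma is_minimal_length_exists:
  assumes "\<exists>L>0. u ^ L - 1 \<in> Idl\<^bsub>R\<^esub> {f, g}"
  shows "\<exists>L. is_minimal_length u f g L"
proof -
  let ?P = "\<lambda>L. L > 0 \<and> u ^ L - 1 \<in> Idl\<^bsub>R\<^esub> {f, g}"
  have "?P (LEAST L. ?P L)" using assms by (rule LeastI_ex)
  then show ?thesis
    unfolding is_minimal_length_def by (intro exI[of _ "LEAST L. ?P L"]) (auto intro: Least_le)
qed

lemma finite_Quot_topological_order:
  assumes "topological_order f g"
  shows "finite (carrier (R Quot (Idl\<^bsub>R\<^esub> {f, g})))"
  unfolding carrier_Quot
proof (rule finite_range_coset[OF assms coset_eq_iff[OF ideal_Idl]])
  fix a b
  have "f \<in> Idl\<^bsub>R\<^esub> {f, g}" "g \<in> Idl\<^bsub>R\<^esub> {f, g}" using subset_Idl[of "{f, g}"] by auto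
  then show "a * g + b * f \<in> Idl\<^bsub>R\<^esub> {f, g}"
    by (intro laurent_idealD(2,3)[OF ideal_Idl])
qed

text \<open>Both sides say that adding the torus relations to \<open>?I\<close> does not enlarge it.
  For the dimensions this rests on the finiteness of \<open>R/?I\<close>, which also keeps
  \<open>k_max\<close> from being a default value of \<open>dim\<close>.\<close>

lemma (in torus) logical_dim_eq_k_max_iff:
  assumes "topological_order f g"
  shows "logical_dim f g Lx Ly = k_max f g \<longleftrightarrow>
    X ^ Lx - 1 \<in> Idl\<^bsub>R\<^esub> {f, g} \<and> Y ^ Ly - 1 \<in> Idl\<^bsub>R\<^esub> {f, g}"
proof -
  let ?I = "Idl\<^bsub>R\<^esub> {f, g}" and ?J = "code_ideal f g"
  have sub: "?I \<subseteq> ?J" by (rule Idl_subset[OF code_ideal(1)]) (use code_ideal in auto)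
  have finI: "finite (carrier (R Quot ?I))" by (rule finite_Quot_topological_order[OF assms])
  have dim: "card (carrier (R Quot K)) = 2 ^ vectorspace.dim \<F>\<^sub>2 (quot_space K)"
    if "ideal K R" "finite (carrier (R Quot K))" for K
    using card_carrier_bit_space[OF quot_space_vectorspace[OF that(1)]] that(2)
    by (simp add: quot_space_def)
  show ?thesis
  proof
    assume "logical_dim f g Lx Ly = k_max f g"
    then have "card (carrier (R Quot ?I)) = card (carrier (R Quot ?J))"
      by (simp only: logical_dim_eq k_max_def dim[OF ideal_Idl finI]
          dim[OF code_ideal(1) finite_Quot_code_ideal] mult_cancel_left of_nat_eq_iff) simp
    then have "?J \<subseteq> ?I"
      by (rule card_coset_eq_imp_subset[OF ideal_Idl code_ideal(1) sub finI])
    then show "X ^ Lx - 1 \<in> ?I \<and> Y ^ Ly - 1 \<in> ?I" using code_ideal(4,5) by blast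
  next
    assume "X ^ Lx - 1 \<in> ?I \<and> Y ^ Ly - 1 \<in> ?I"
    then have "?J \<subseteq> ?I"
      unfolding code_ideal_def using subset_Idl[of "{f, g}"] by (intro Idl_subset[OF ideal_Idl]) auto
    with sub have "?J = ?I" by blast
    then show "logical_dim f g Lx Ly = k_max f g" by (simp only: logical_dim_eq k_max_def)
  qed
qed

theorem theorem2:
  fixes f g :: laurent
  assumes "topological_order f g"
  shows "\<exists>Lx\<^sub>0 Ly\<^sub>0.
    is_minimal_length X f g Lx\<^sub>0 \<and> is_minimal_length Y f g Ly\<^sub>0 \<and>
    logical_dim f g Lx\<^sub>0 Ly\<^sub>0 = k_max f g \<and>
    (\<forall>Lx Ly. Lx \<ge> 1 \<and> Ly \<ge> 1 \<and> logical_dim f g Lx Ly = k_max f g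
      \<longrightarrow> Lx \<ge> Lx\<^sub>0 \<and> Ly \<ge> Ly\<^sub>0)"
proof -
  note iff = torus.logical_dim_eq_k_max_iff[OF torus.intro assms]
  have "X * lmonom (- 1, 0) = 1" "Y * lmonom (0, - 1) = 1"
    by (simp_all add: lmonom_mult lmonom_0[unfolded zero_prod_def])
  then obtain Lx Ly where min: "is_minimal_length X f g Lx" "is_minimal_length Y f g Ly"
    using unit_power_diff_1_mem[OF ideal_Idl finite_Quot_topological_order[OF assms]]
      is_minimal_length_exists by metis
  then have "logical_dim f g Lx Ly = k_max f g"
    by (subst iff) (auto simp: is_minimal_length_def)
  \<comment> \<open>Maximal dimension puts both torus relations into the ideal, so each length is
    bounded by its own minimality.\<close>
  moreover have "Lx' \<ge> Lx \<and> Ly' \<ge> Ly"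
    if "Lx' \<ge> 1" "Ly' \<ge> 1" "logical_dim f g Lx' Ly' = k_max f g" for Lx' Ly'
    using min that iff[of Lx' Ly'] by (auto simp: is_minimal_length_def)
  ultimately show ?thesis using min by blast
qed

end
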